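(* Let $D$ be a Prüfer domain, let $I$ be an ideal of $D$, let $n\in\mathbb{N}$, and let $A$ be a $1$-principled $n\times n$-matrix over $D/I$. Then $A^m$ is $1$-principled for every $m\in\mathbb{Z}$.
   Context: All rings are commutative, associative and unital; $\mathbb{N}=\{0,1,2,\ldots\}$ and $[n]:=\{1,2,\ldots,n\}$. For an $n\times n$-matrix $A$ over a ring and $S\subseteq[n]$, $A_S$ denotes the principal submatrix of $A$ with row and column set $S$; the empty determinant is $1$. The matrix $A$ is $1$-principled if $\det A_S = 1$ for every $S\subseteq[n]$. (Such a matrix has determinant $1$, hence is invertible, so $A^m$ is defined for every integer $m$.) Let $D$ be an integral domain with fraction field $K$. A nonzero fractional ideal $L$ of $D$ is invertible if there exists a fractional ideal $M$ such that $LM=D$. $D$ is a Prüfer domain if every nonzero finitely generated ideal of $D$ is invertible. *)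

theory Defs
  imports "HOL-Algebra.Algebra" "HOL-Combinatorics.Permutations"
begin

section \<open>The fraction field of an integral domain\<close>

definition frac_rel :: "('a, 'b) ring_scheme \<Rightarrow> (('a \<times> 'a) \<times> ('a \<times> 'a)) set" where
  "frac_rel D = {((a, b), (c, d)).
     a \<in> carrier D \<and> b \<in> carrier D - {\<zero>\<^bsub>D\<^esub>} \<and> c \<in> carrier D \<and> d \<in> carrier D - {\<zero>\<^bsub>D\<^esub>} \<and>
     a \<otimes>\<^bsub>D\<^esub> d = c \<otimes>\<^bsub>D\<^esub> b}"

definition frac_class :: "('a, 'b) ring_scheme \<Rightarrow> 'a \<Rightarrow> 'a \<Rightarrow> ('a \<times> 'a) set" where
  "frac_class D a b = frac_rel D `` {(a, b)}"

text \<open>The unions below range over all representatives; they collapse to a single class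
  because the operations respect \<^const>\<open>frac_rel\<close>.\<close>

definition fraction_field :: "('a, 'b) ring_scheme \<Rightarrow> ('a \<times> 'a) set ring" where
  "fraction_field D =
    \<lparr>carrier = (carrier D \<times> (carrier D - {\<zero>\<^bsub>D\<^esub>})) // frac_rel D,
     monoid.mult = (\<lambda>x y. \<Union>(a, b)\<in>x. \<Union>(c, d)\<in>y. frac_class D (a \<otimes>\<^bsub>D\<^esub> c) (b \<otimes>\<^bsub>D\<^esub> d)),
     monoid.one = frac_class D \<one>\<^bsub>D\<^esub> \<one>\<^bsub>D\<^esub>,
     ring.zero = frac_class D \<zero>\<^bsub>D\<^esub> \<one>\<^bsub>D\<^esub>,
     ring.add = (\<lambda>x y. \<Union>(a, b)\<in>x. \<Union>(c, d)\<in>y.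
        frac_class D (a \<otimes>\<^bsub>D\<^esub> d \<oplus>\<^bsub>D\<^esub> c \<otimes>\<^bsub>D\<^esub> b) (b \<otimes>\<^bsub>D\<^esub> d))\<rparr>"

definition frac_embed :: "('a, 'b) ring_scheme \<Rightarrow> 'a \<Rightarrow> ('a \<times> 'a) set" where
  "frac_embed D a = frac_class D a \<one>\<^bsub>D\<^esub>"

context "domain"
begin

lemma frac_rel_equiv: "equiv (carrier R \<times> (carrier R - {\<zero>})) (frac_rel R)"
proof (rule equivI)
  show "frac_rel R \<subseteq> (carrier R \<times> (carrier R - {\<zero>})) \<times> (carrier R \<times> (carrier R - {\<zero>}))"
    by (auto simp: frac_rel_def)
  show "refl_on (carrier R \<times> (carrier R - {\<zero>})) (frac_rel R)"
    by (auto simp: refl_on_def frac_rel_def)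
  show "sym (frac_rel R)"
    by (auto simp: sym_def frac_rel_def)
  show "trans (frac_rel R)"
  proof (rule transI, clarify)
    fix a b c d e f
    assume "((a, b), (c, d)) \<in> frac_rel R" "((c, d), (e, f)) \<in> frac_rel R"
    then have cl: "a \<in> carrier R" "b \<in> carrier R" "c \<in> carrier R" "d \<in> carrier R"
        "e \<in> carrier R" "f \<in> carrier R"
      and nz: "b \<noteq> \<zero>" "d \<noteq> \<zero>" "f \<noteq> \<zero>"
      and eq: "a \<otimes> d = c \<otimes> b" "c \<otimes> f = e \<otimes> d"
      by (auto simp: frac_rel_def)
    have "d \<otimes> (a \<otimes> f) = (a \<otimes> d) \<otimes> f" using cl by (simp add: m_ac)
    also have "\<dots> = (c \<otimes> f) \<otimes> b" unfolding eq(1) using cl by (simp add: m_ac)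
    also have "\<dots> = d \<otimes> (e \<otimes> b)" unfolding eq(2) using cl by (simp add: m_ac)
    finally have "a \<otimes> f = e \<otimes> b" using cl nz m_lcancel by simp
    then show "((a, b), (e, f)) \<in> frac_rel R" using cl nz by (simp add: frac_rel_def)
  qed
qed

lemma frac_eq_iff:
  assumes "a \<in> carrier R" "b \<in> carrier R - {\<zero>}" "c \<in> carrier R" "d \<in> carrier R - {\<zero>}"
  shows "frac_class R a b = frac_class R c d \<longleftrightarrow> a \<otimes> d = c \<otimes> b"
  unfolding frac_class_def using assms
  by (subst eq_equiv_class_iff[OF frac_rel_equiv]) (auto simp: frac_rel_def)

lemma frac_mem:
  assumes "p \<in> frac_class R a b"
  obtains c d where "p = (c, d)" "c \<in> carrier R" "d \<in> carrier R - {\<zero>}" "a \<otimes> d = c \<otimes> b"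
  using assms by (cases p) (auto simp: frac_class_def frac_rel_def)

lemma frac_self: "a \<in> carrier R \<Longrightarrow> b \<in> carrier R - {\<zero>} \<Longrightarrow> (a, b) \<in> frac_class R a b"
  by (auto simp: frac_class_def frac_rel_def)

lemma denom_mult: "b \<in> carrier R - {\<zero>} \<Longrightarrow> d \<in> carrier R - {\<zero>} \<Longrightarrow> b \<otimes> d \<in> carrier R - {\<zero>}"
  using integral by auto

lemma frac_mult:
  assumes "a \<in> carrier R" "b \<in> carrier R - {\<zero>}" "c \<in> carrier R" "d \<in> carrier R - {\<zero>}"
  shows "frac_class R a b \<otimes>\<^bsub>fraction_field R\<^esub> frac_class R c d = frac_class R (a \<otimes> c) (b \<otimes> d)"
proof -
  have *: "frac_class R (a' \<otimes> c') (b' \<otimes> d') = frac_class R (a \<otimes> c) (b \<otimes> d)"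
    if 1: "(a', b') \<in> frac_class R a b" and 2: "(c', d') \<in> frac_class R c d" for a' b' c' d'
  proof -
    have cl: "a' \<in> carrier R" "b' \<in> carrier R - {\<zero>}" "c' \<in> carrier R" "d' \<in> carrier R - {\<zero>}"
      and eq: "a \<otimes> b' = a' \<otimes> b" "c \<otimes> d' = c' \<otimes> d"
      using 1 2 by (auto elim!: frac_mem)
    have "(a' \<otimes> c') \<otimes> (b \<otimes> d) = (a' \<otimes> b) \<otimes> (c' \<otimes> d)"
      using cl assms by (simp add: m_ac)
    also have "\<dots> = (a \<otimes> c) \<otimes> (b' \<otimes> d')"
      unfolding eq[symmetric] using cl assms by (simp add: m_ac)
    finally show ?thesis
      by (subst frac_eq_iff) (use cl assms denom_mult in blast)+
  qed
  have "(a, b) \<in> frac_class R a b" "(c, d) \<in> frac_class R c d" using assms frac_self by auto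
  then show ?thesis unfolding fraction_field_def monoid.simps using * by fast
qed

lemma frac_add:
  assumes "a \<in> carrier R" "b \<in> carrier R - {\<zero>}" "c \<in> carrier R" "d \<in> carrier R - {\<zero>}"
  shows "frac_class R a b \<oplus>\<^bsub>fraction_field R\<^esub> frac_class R c d = frac_class R (a \<otimes> d \<oplus> c \<otimes> b) (b \<otimes> d)"
proof -
  have *: "frac_class R (a' \<otimes> d' \<oplus> c' \<otimes> b') (b' \<otimes> d') = frac_class R (a \<otimes> d \<oplus> c \<otimes> b) (b \<otimes> d)"
    if 1: "(a', b') \<in> frac_class R a b" and 2: "(c', d') \<in> frac_class R c d" for a' b' c' d'
  proof -
    have cl: "a' \<in> carrier R" "b' \<in> carrier R - {\<zero>}" "c' \<in> carrier R" "d' \<in> carrier R - {\<zero>}"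
      and eq: "a \<otimes> b' = a' \<otimes> b" "c \<otimes> d' = c' \<otimes> d"
      using 1 2 by (auto elim!: frac_mem)
    have "(a' \<otimes> d' \<oplus> c' \<otimes> b') \<otimes> (b \<otimes> d) = (a' \<otimes> b) \<otimes> (d \<otimes> d') \<oplus> (c' \<otimes> d) \<otimes> (b \<otimes> b')"
      using cl assms by (simp add: m_ac l_distr r_distr)
    also have "\<dots> = (a \<otimes> d \<oplus> c \<otimes> b) \<otimes> (b' \<otimes> d')"
      unfolding eq[symmetric] using cl assms by (simp add: m_ac l_distr r_distr)
    finally show ?thesis
      by (subst frac_eq_iff) (use cl assms denom_mult in blast)+
  qed
  have "(a, b) \<in> frac_class R a b" "(c, d) \<in> frac_class R c d" using assms frac_self by auto
  then show ?thesis unfolding fraction_field_def ring_record_simps using * by fast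
qed

lemma frac_closed:
  "a \<in> carrier R \<Longrightarrow> b \<in> carrier R - {\<zero>} \<Longrightarrow> frac_class R a b \<in> carrier (fraction_field R)"
  by (auto simp: fraction_field_def frac_class_def intro!: quotientI)

lemma frac_cases:
  assumes "x \<in> carrier (fraction_field R)"
  obtains a b where "a \<in> carrier R" "b \<in> carrier R - {\<zero>}" "x = frac_class R a b"
  using assms by (auto simp: fraction_field_def frac_class_def elim!: quotientE)

lemma frac_one: "\<one>\<^bsub>fraction_field R\<^esub> = frac_class R \<one> \<one>"
  and frac_zero: "\<zero>\<^bsub>fraction_field R\<^esub> = frac_class R \<zero> \<one>"
  by (simp_all add: fraction_field_def)

lemma frac_field: "field (fraction_field R)"
proof -
  have one: "\<one> \<in> carrier R - {\<zero>}" by simp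
  note s = frac_mult frac_add frac_one frac_zero frac_closed denom_mult one frac_eq_iff
  have cring: "cring (fraction_field R)"
  proof (rule cringI)
    show "abelian_group (fraction_field R)"
    proof (rule abelian_groupI)
      fix x y assume "x \<in> carrier (fraction_field R)" "y \<in> carrier (fraction_field R)"
      then obtain a b c d where *: "a \<in> carrier R" "b \<in> carrier R - {\<zero>}" "x = frac_class R a b"
        "c \<in> carrier R" "d \<in> carrier R - {\<zero>}" "y = frac_class R c d"
        by (metis frac_cases)
      then have bd: "b \<otimes> d \<in> carrier R - {\<zero>}" "d \<otimes> b \<in> carrier R - {\<zero>}"
        using denom_mult by blast+
      show "x \<oplus>\<^bsub>fraction_field R\<^esub> y \<in> carrier (fraction_field R)"
        unfolding *(3,6) by (subst frac_add) (use * bd in \<open>auto intro!: frac_closed\<close>)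
      show "x \<oplus>\<^bsub>fraction_field R\<^esub> y = y \<oplus>\<^bsub>fraction_field R\<^esub> x"
        unfolding *(3,6) using * bd by (simp add: frac_add a_comm m_comm)
    next
      fix x y z assume "x \<in> carrier (fraction_field R)" "y \<in> carrier (fraction_field R)"
        "z \<in> carrier (fraction_field R)"
      then obtain a b c d e f where *: "a \<in> carrier R" "b \<in> carrier R - {\<zero>}" "x = frac_class R a b"
        "c \<in> carrier R" "d \<in> carrier R - {\<zero>}" "y = frac_class R c d"
        "e \<in> carrier R" "f \<in> carrier R - {\<zero>}" "z = frac_class R e f"
        by (metis frac_cases)
      then have bd: "b \<otimes> d \<in> carrier R - {\<zero>}" "d \<otimes> f \<in> carrier R - {\<zero>}"
        using denom_mult by blast+
      show "x \<oplus>\<^bsub>fraction_field R\<^esub> y \<oplus>\<^bsub>fraction_field R\<^esub> z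
          = x \<oplus>\<^bsub>fraction_field R\<^esub> (y \<oplus>\<^bsub>fraction_field R\<^esub> z)"
        unfolding *(3,6,9) using * bd by (simp add: frac_add l_distr r_distr a_ac m_ac)
    next
      show "\<zero>\<^bsub>fraction_field R\<^esub> \<in> carrier (fraction_field R)"
        by (simp add: s)
    next
      fix x assume "x \<in> carrier (fraction_field R)"
      then obtain a b where *: "a \<in> carrier R" "b \<in> carrier R - {\<zero>}" "x = frac_class R a b"
        by (metis frac_cases)
      then have bb: "b \<otimes> b \<in> carrier R - {\<zero>}" using denom_mult by blast
      show "\<zero>\<^bsub>fraction_field R\<^esub> \<oplus>\<^bsub>fraction_field R\<^esub> x = x"
        unfolding *(3) using * by (simp add: frac_add frac_zero)
      have "frac_class R (\<ominus> a) b \<oplus>\<^bsub>fraction_field R\<^esub> x = \<zero>\<^bsub>fraction_field R\<^esub>"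
        unfolding *(3) using * bb by (simp add: frac_add frac_zero frac_eq_iff l_minus l_neg)
      then show "\<exists>y\<in>carrier (fraction_field R). y \<oplus>\<^bsub>fraction_field R\<^esub> x = \<zero>\<^bsub>fraction_field R\<^esub>"
        using * by (auto intro!: bexI[of _ "frac_class R (\<ominus> a) b"] frac_closed)
    qed
    show "comm_monoid (fraction_field R)"
    proof (rule comm_monoidI)
      fix x y assume "x \<in> carrier (fraction_field R)" "y \<in> carrier (fraction_field R)"
      then obtain a b c d where *: "a \<in> carrier R" "b \<in> carrier R - {\<zero>}" "x = frac_class R a b"
        "c \<in> carrier R" "d \<in> carrier R - {\<zero>}" "y = frac_class R c d"
        by (metis frac_cases)
      then have bd: "b \<otimes> d \<in> carrier R - {\<zero>}" using denom_mult by blast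
      show "x \<otimes>\<^bsub>fraction_field R\<^esub> y \<in> carrier (fraction_field R)"
        unfolding *(3,6) by (subst frac_mult) (use * bd in \<open>auto intro!: frac_closed\<close>)
      show "x \<otimes>\<^bsub>fraction_field R\<^esub> y = y \<otimes>\<^bsub>fraction_field R\<^esub> x"
        unfolding *(3,6) using * by (simp add: frac_mult m_comm)
    next
      fix x y z assume "x \<in> carrier (fraction_field R)" "y \<in> carrier (fraction_field R)"
        "z \<in> carrier (fraction_field R)"
      then obtain a b c d e f where *: "a \<in> carrier R" "b \<in> carrier R - {\<zero>}" "x = frac_class R a b"
        "c \<in> carrier R" "d \<in> carrier R - {\<zero>}" "y = frac_class R c d"
        "e \<in> carrier R" "f \<in> carrier R - {\<zero>}" "z = frac_class R e f"
        by (metis frac_cases)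
      then have bd: "b \<otimes> d \<in> carrier R - {\<zero>}" "d \<otimes> f \<in> carrier R - {\<zero>}"
        using denom_mult by blast+
      show "x \<otimes>\<^bsub>fraction_field R\<^esub> y \<otimes>\<^bsub>fraction_field R\<^esub> z
          = x \<otimes>\<^bsub>fraction_field R\<^esub> (y \<otimes>\<^bsub>fraction_field R\<^esub> z)"
        unfolding *(3,6,9) using * bd by (simp add: frac_mult m_assoc)
    next
      show "\<one>\<^bsub>fraction_field R\<^esub> \<in> carrier (fraction_field R)"
        by (simp add: s)
    next
      fix x assume "x \<in> carrier (fraction_field R)"
      then obtain a b where *: "a \<in> carrier R" "b \<in> carrier R - {\<zero>}" "x = frac_class R a b"
        by (metis frac_cases)
      show "\<one>\<^bsub>fraction_field R\<^esub> \<otimes>\<^bsub>fraction_field R\<^esub> x = x"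
        unfolding *(3) using * by (simp add: frac_mult frac_one)
    qed
    fix x y z assume "x \<in> carrier (fraction_field R)" "y \<in> carrier (fraction_field R)"
      "z \<in> carrier (fraction_field R)"
    then obtain a b c d e f where *: "a \<in> carrier R" "b \<in> carrier R - {\<zero>}" "x = frac_class R a b"
      "c \<in> carrier R" "d \<in> carrier R - {\<zero>}" "y = frac_class R c d"
      "e \<in> carrier R" "f \<in> carrier R - {\<zero>}" "z = frac_class R e f"
      by (metis frac_cases)
    then have bd: "b \<otimes> d \<in> carrier R - {\<zero>}" "b \<otimes> f \<in> carrier R - {\<zero>}" "d \<otimes> f \<in> carrier R - {\<zero>}"
      "b \<otimes> d \<otimes> f \<in> carrier R - {\<zero>}" "b \<otimes> f \<otimes> (d \<otimes> f) \<in> carrier R - {\<zero>}"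
      using denom_mult by blast+
    show "(x \<oplus>\<^bsub>fraction_field R\<^esub> y) \<otimes>\<^bsub>fraction_field R\<^esub> z
        = x \<otimes>\<^bsub>fraction_field R\<^esub> z \<oplus>\<^bsub>fraction_field R\<^esub> y \<otimes>\<^bsub>fraction_field R\<^esub> z"
      unfolding *(3,6,9) using * bd by (simp add: frac_mult frac_add frac_eq_iff l_distr r_distr m_ac)
  qed
  show ?thesis
  proof (rule cring.cring_fieldI2[OF cring])
    show "\<zero>\<^bsub>fraction_field R\<^esub> \<noteq> \<one>\<^bsub>fraction_field R\<^esub>"
      by (simp add: frac_one frac_zero frac_eq_iff)
  next
    fix x assume "x \<in> carrier (fraction_field R)" and nz: "x \<noteq> \<zero>\<^bsub>fraction_field R\<^esub>"
    then obtain a b where *: "a \<in> carrier R" "b \<in> carrier R - {\<zero>}" "x = frac_class R a b"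
      by (metis frac_cases)
    with nz have a: "a \<in> carrier R - {\<zero>}" by (auto simp: frac_zero frac_eq_iff)
    have ab: "a \<otimes> b \<in> carrier R - {\<zero>}" using a * denom_mult by blast
    have "x \<otimes>\<^bsub>fraction_field R\<^esub> frac_class R b a = \<one>\<^bsub>fraction_field R\<^esub>"
      unfolding *(3) using * a ab by (simp add: frac_mult frac_one frac_eq_iff m_comm)
    then show "\<exists>y\<in>carrier (fraction_field R). x \<otimes>\<^bsub>fraction_field R\<^esub> y = \<one>\<^bsub>fraction_field R\<^esub>"
      using * a by (auto intro!: bexI[of _ "frac_class R b a"] frac_closed)
  qed
qed

lemma frac_embed_hom: "frac_embed R \<in> ring_hom R (fraction_field R)"
  by (rule ring_hom_memI) (auto simp: frac_embed_def frac_closed frac_mult frac_add frac_one)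

lemma frac_embed_inj: "inj_on (frac_embed R) (carrier R)"
  by (auto simp: inj_on_def frac_embed_def frac_eq_iff)

lemma frac_conv_embed:
  assumes "a \<in> carrier R" "b \<in> carrier R - {\<zero>}"
  shows "frac_class R a b \<otimes>\<^bsub>fraction_field R\<^esub> frac_embed R b = frac_embed R a"
  using assms by (simp add: frac_embed_def frac_mult frac_eq_iff)

end


section \<open>Fractional ideals and Pruefer domains\<close>

definition fractional_ideal :: "('a, 'b) ring_scheme \<Rightarrow> ('a \<times> 'a) set set \<Rightarrow> bool" where
  "fractional_ideal D M \<longleftrightarrow>
     additive_subgroup M (fraction_field D) \<and>
     (\<forall>d\<in>carrier D. \<forall>x\<in>M. frac_embed D d \<otimes>\<^bsub>fraction_field D\<^esub> x \<in> M) \<and>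
     (\<exists>d\<in>carrier D - {\<zero>\<^bsub>D\<^esub>}. \<forall>x\<in>M.
        frac_embed D d \<otimes>\<^bsub>fraction_field D\<^esub> x \<in> frac_embed D ` carrier D)"

text \<open>\<^const>\<open>ideal_prod\<close> is the closure of the set of products under addition, so taken in the
  fraction field it is the usual product of two fractional ideals.\<close>

definition invertible_fractional_ideal :: "('a, 'b) ring_scheme \<Rightarrow> ('a \<times> 'a) set set \<Rightarrow> bool" where
  "invertible_fractional_ideal D L \<longleftrightarrow>
     fractional_ideal D L \<and> L \<noteq> {\<zero>\<^bsub>fraction_field D\<^esub>} \<and>
     (\<exists>M. fractional_ideal D M \<and>
        ideal_prod (fraction_field D) L M = frac_embed D ` carrier D)"

definition prufer_domain :: "('a, 'b) ring_scheme \<Rightarrow> bool" where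
  "prufer_domain D \<longleftrightarrow> domain D \<and>
     (\<forall>S. finite S \<and> S \<subseteq> carrier D \<and> Idl\<^bsub>D\<^esub> S \<noteq> {\<zero>\<^bsub>D\<^esub>} \<longrightarrow>
        invertible_fractional_ideal D (frac_embed D ` (Idl\<^bsub>D\<^esub> S)))"


section \<open>Matrices and principal minors\<close>

text \<open>A square matrix over \<open>R\<close> with row and column set \<open>S\<close> is an extensional function on
  \<open>S \<times> S\<close>; an \<open>n \<times> n\<close>-matrix is the case \<open>S = {1..n}\<close>.\<close>

definition square_mats :: "('a, 'b) ring_scheme \<Rightarrow> 'i set \<Rightarrow> ('i \<times> 'i \<Rightarrow> 'a) set" where
  "square_mats R S = (S \<times> S) \<rightarrow>\<^sub>E carrier R"

definition mat_monoid :: "('a, 'b) ring_scheme \<Rightarrow> nat \<Rightarrow> (nat \<times> nat \<Rightarrow> 'a) monoid" where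
  "mat_monoid R n =
    \<lparr>carrier = square_mats R {1..n},
     monoid.mult = (\<lambda>A B. restrict (\<lambda>(i, k). \<Oplus>\<^bsub>R\<^esub>j\<in>{1..n}. A (i, j) \<otimes>\<^bsub>R\<^esub> B (j, k)) ({1..n} \<times> {1..n})),
     monoid.one = restrict (\<lambda>(i, j). if i = j then \<one>\<^bsub>R\<^esub> else \<zero>\<^bsub>R\<^esub>) ({1..n} \<times> {1..n})\<rparr>"

definition mat_det :: "('a, 'b) ring_scheme \<Rightarrow> 'i set \<Rightarrow> ('i \<times> 'i \<Rightarrow> 'a) \<Rightarrow> 'a" where
  "mat_det R S A = (\<Oplus>\<^bsub>R\<^esub>p\<in>{p. p permutes S}.
     if evenperm p then (\<Otimes>\<^bsub>R\<^esub>i\<in>S. A (i, p i)) else \<ominus>\<^bsub>R\<^esub> (\<Otimes>\<^bsub>R\<^esub>i\<in>S. A (i, p i)))"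

definition principal_submatrix :: "('i \<times> 'i \<Rightarrow> 'a) \<Rightarrow> 'i set \<Rightarrow> 'i \<times> 'i \<Rightarrow> 'a" where
  "principal_submatrix A S = restrict A (S \<times> S)"

definition one_principled :: "('a, 'b) ring_scheme \<Rightarrow> nat \<Rightarrow> (nat \<times> nat \<Rightarrow> 'a) \<Rightarrow> bool" where
  "one_principled R n A \<longleftrightarrow> A \<in> square_mats R {1..n} \<and>
     (\<forall>S\<subseteq>{1..n}. mat_det R S (principal_submatrix A S) = \<one>\<^bsub>R\<^esub>)"

lemma (in cring) mat_det_empty: "mat_det R {} A = \<one>"
  by (simp add: mat_det_def)

lemma (in abelian_monoid) finsum_finsum_swap:
  assumes "finite S" "finite T" "\<And>i j. i \<in> S \<Longrightarrow> j \<in> T \<Longrightarrow> f i j \<in> carrier G"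
  shows "(\<Oplus>i\<in>S. \<Oplus>j\<in>T. f i j) = (\<Oplus>j\<in>T. \<Oplus>i\<in>S. f i j)"
  using assms(1,3)
proof (induction S rule: finite_induct)
  case empty
  then show ?case by simp
next
  case (insert x F)
  have "(\<Oplus>i\<in>insert x F. \<Oplus>j\<in>T. f i j) = (\<Oplus>j\<in>T. f x j) \<oplus> (\<Oplus>j\<in>T. \<Oplus>i\<in>F. f i j)"
    using insert by (subst finsum_insert) (auto intro!: finsum_closed)
  also have "\<dots> = (\<Oplus>j\<in>T. f x j \<oplus> (\<Oplus>i\<in>F. f i j))"
    using insert.prems by (intro finsum_addf[symmetric]) (auto intro!: finsum_closed)
  also have "\<dots> = (\<Oplus>j\<in>T. \<Oplus>i\<in>insert x F. f i j)"
    using insert by (intro finsum_cong') (auto intro!: finsum_closed)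
  finally show ?case .
qed

lemma (in ring) mat_monoid_monoid: "monoid (mat_monoid R n)"
proof (rule monoidI)
  fix A B assume A: "A \<in> carrier (mat_monoid R n)" and B: "B \<in> carrier (mat_monoid R n)"
  then have cl: "\<And>i j. i \<in> {1..n} \<Longrightarrow> j \<in> {1..n} \<Longrightarrow> A (i, j) \<in> carrier R"
    "\<And>i j. i \<in> {1..n} \<Longrightarrow> j \<in> {1..n} \<Longrightarrow> B (i, j) \<in> carrier R"
    by (auto simp: mat_monoid_def square_mats_def PiE_iff)
  then show "A \<otimes>\<^bsub>mat_monoid R n\<^esub> B \<in> carrier (mat_monoid R n)"
    by (auto simp: mat_monoid_def square_mats_def intro!: finsum_closed)
next
  show "\<one>\<^bsub>mat_monoid R n\<^esub> \<in> carrier (mat_monoid R n)"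
    by (auto simp: mat_monoid_def square_mats_def)
next
  fix A B C assume A: "A \<in> carrier (mat_monoid R n)" and B: "B \<in> carrier (mat_monoid R n)"
    and C: "C \<in> carrier (mat_monoid R n)"
  then have cl: "\<And>i j. i \<in> {1..n} \<Longrightarrow> j \<in> {1..n} \<Longrightarrow> A (i, j) \<in> carrier R"
    "\<And>i j. i \<in> {1..n} \<Longrightarrow> j \<in> {1..n} \<Longrightarrow> B (i, j) \<in> carrier R"
    "\<And>i j. i \<in> {1..n} \<Longrightarrow> j \<in> {1..n} \<Longrightarrow> C (i, j) \<in> carrier R"
    by (auto simp: mat_monoid_def square_mats_def PiE_iff)
  have "(\<Oplus>k\<in>{1..n}. (\<Oplus>j\<in>{1..n}. A (i, j) \<otimes> B (j, k)) \<otimes> C (k, l))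
      = (\<Oplus>j\<in>{1..n}. A (i, j) \<otimes> (\<Oplus>k\<in>{1..n}. B (j, k) \<otimes> C (k, l)))"
    if il: "i \<in> {1..n}" "l \<in> {1..n}" for i l
  proof -
    have "(\<Oplus>k\<in>{1..n}. (\<Oplus>j\<in>{1..n}. A (i, j) \<otimes> B (j, k)) \<otimes> C (k, l))
        = (\<Oplus>k\<in>{1..n}. \<Oplus>j\<in>{1..n}. A (i, j) \<otimes> B (j, k) \<otimes> C (k, l))"
      by (intro finsum_cong' finsum_ldistr) (auto intro!: finsum_closed cl il simp del: atLeastAtMost_iff One_nat_def)
    also have "\<dots> = (\<Oplus>j\<in>{1..n}. \<Oplus>k\<in>{1..n}. A (i, j) \<otimes> B (j, k) \<otimes> C (k, l))"
      by (rule finsum_finsum_swap) (auto intro!: cl il simp del: atLeastAtMost_iff One_nat_def)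
    also have "\<dots> = (\<Oplus>j\<in>{1..n}. A (i, j) \<otimes> (\<Oplus>k\<in>{1..n}. B (j, k) \<otimes> C (k, l)))"
    proof (intro finsum_cong')
      fix j assume j: "j \<in> {1..n}"
      have "(\<Oplus>k\<in>{1..n}. A (i, j) \<otimes> B (j, k) \<otimes> C (k, l))
          = (\<Oplus>k\<in>{1..n}. A (i, j) \<otimes> (B (j, k) \<otimes> C (k, l)))"
        by (intro finsum_cong') (auto intro!: m_assoc cl il j simp del: atLeastAtMost_iff One_nat_def)
      also have "\<dots> = A (i, j) \<otimes> (\<Oplus>k\<in>{1..n}. B (j, k) \<otimes> C (k, l))"
        by (rule finsum_rdistr[symmetric]) (auto intro!: cl il j simp del: atLeastAtMost_iff One_nat_def)
      finally show "(\<Oplus>k\<in>{1..n}. A (i, j) \<otimes> B (j, k) \<otimes> C (k, l))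
          = A (i, j) \<otimes> (\<Oplus>k\<in>{1..n}. B (j, k) \<otimes> C (k, l))" .
    qed (auto intro!: finsum_closed cl il simp del: atLeastAtMost_iff One_nat_def)
    finally show ?thesis .
  qed
  note assoc = this
  show "A \<otimes>\<^bsub>mat_monoid R n\<^esub> B \<otimes>\<^bsub>mat_monoid R n\<^esub> C
      = A \<otimes>\<^bsub>mat_monoid R n\<^esub> (B \<otimes>\<^bsub>mat_monoid R n\<^esub> C)"
    unfolding mat_monoid_def monoid.simps
  proof (rule restrict_ext, clarify)
    fix i l assume il: "i \<in> {1..n}" "l \<in> {1..n}"
    show "(\<Oplus>k\<in>{1..n}. restrict (\<lambda>(i, k). \<Oplus>j\<in>{1..n}. A (i, j) \<otimes> B (j, k)) ({1..n} \<times> {1..n}) (i, k) \<otimes> C (k, l))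
      = (\<Oplus>j\<in>{1..n}. A (i, j) \<otimes> restrict (\<lambda>(i, k). \<Oplus>j\<in>{1..n}. B (i, j) \<otimes> C (j, k)) ({1..n} \<times> {1..n}) (j, l))"
      (is "?L = ?R")
    proof -
      have "?L = (\<Oplus>k\<in>{1..n}. (\<Oplus>j\<in>{1..n}. A (i, j) \<otimes> B (j, k)) \<otimes> C (k, l))"
        using il by (intro finsum_cong') (auto intro!: m_closed finsum_closed cl)
      moreover have "?R = (\<Oplus>j\<in>{1..n}. A (i, j) \<otimes> (\<Oplus>k\<in>{1..n}. B (j, k) \<otimes> C (k, l)))"
        using il by (intro finsum_cong') (auto intro!: m_closed finsum_closed cl)
      ultimately show ?thesis using assoc[OF il] by simp
    qed
  qed
next
  fix A assume A: "A \<in> carrier (mat_monoid R n)"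
  then have cl: "\<And>i j. i \<in> {1..n} \<Longrightarrow> j \<in> {1..n} \<Longrightarrow> A (i, j) \<in> carrier R"
    and ext: "A \<in> extensional ({1..n} \<times> {1..n})"
    by (auto simp: mat_monoid_def square_mats_def PiE_iff)
  show "\<one>\<^bsub>mat_monoid R n\<^esub> \<otimes>\<^bsub>mat_monoid R n\<^esub> A = A"
  proof (rule extensionalityI[OF _ ext], simp add: mat_monoid_def, clarify)
    fix i k assume ik: "i \<in> {1..n}" "k \<in> {1..n}"
    have "(\<Oplus>j\<in>{1..n}. \<one>\<^bsub>mat_monoid R n\<^esub> (i, j) \<otimes> A (j, k))
        = (\<Oplus>j\<in>{1..n}. if i = j then A (j, k) else \<zero>)"
      by (intro finsum_cong') (use ik cl in \<open>auto simp: mat_monoid_def\<close>)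
    also have "\<dots> = A (i, k)" using ik cl by (intro add.finprod_singleton) auto
    finally show "(\<one>\<^bsub>mat_monoid R n\<^esub> \<otimes>\<^bsub>mat_monoid R n\<^esub> A) (i, k) = A (i, k)"
      using ik by (simp add: mat_monoid_def)
  qed
  show "A \<otimes>\<^bsub>mat_monoid R n\<^esub> \<one>\<^bsub>mat_monoid R n\<^esub> = A"
  proof (rule extensionalityI[OF _ ext], simp add: mat_monoid_def, clarify)
    fix i k assume ik: "i \<in> {1..n}" "k \<in> {1..n}"
    have "(\<Oplus>j\<in>{1..n}. A (i, j) \<otimes> \<one>\<^bsub>mat_monoid R n\<^esub> (j, k))
        = (\<Oplus>j\<in>{1..n}. if k = j then A (i, j) else \<zero>)"
      by (intro finsum_cong') (use ik cl in \<open>auto simp: mat_monoid_def\<close>)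
    also have "\<dots> = A (i, k)" using ik cl by (intro add.finprod_singleton) auto
    finally show "(A \<otimes>\<^bsub>mat_monoid R n\<^esub> \<one>\<^bsub>mat_monoid R n\<^esub>) (i, k) = A (i, k)"
      using ik by (simp add: mat_monoid_def)
  qed
qed

end

theory Submission
  imports Defs "HOL-Library.Multiset"
begin

text \<open>
  Call the product of the entries of a matrix along a cycle of length at least two a cycle
  product. A matrix with ones on the diagonal all of whose cycle products vanish is
  \<open>1\<close>-principled, because every permutation other than the identity contains such a cycle. Over the
  quotient of a Pruefer domain the converse holds as well
  (\<open>prufer_quotient_cycles_vanish\<close>), and the vanishing of all cycle products is inherited by powers.

  For the converse, all permutations other than the identity contribute products with sum zero
  to the principal minor on a set \<open>S\<close>, and one has to see that each of them is zero.
  By induction this is known for everything that contains a cycle on fewer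
  vertices. Given two different permutations of \<open>S\<close> without fixed points, the union of their edges
  contains two disjoint sets of cycles on fewer vertices
  (\<open>two_bijections_contain_two_smaller\<close>). Lifted to the domain \<open>D\<close>, the two products \<open>x, y\<close> hence
  satisfy \<open>x y = c d r\<close> with \<open>c, d\<close> in \<open>I\<close>. In a valuation ring this puts \<open>x\<close> or \<open>y\<close> into \<open>I\<close>:
  if, say, \<open>y\<close> divides \<open>x\<close> and \<open>d\<close> divides \<open>c\<close>, then \<open>d\<^sup>2\<close> divides \<open>x\<^sup>2\<close>, so \<open>d\<close> divides \<open>x\<close>. Thus
  at most one of the products is nonzero, and as they sum to zero, none is. A Pruefer domain is
  locally a valuation ring. Instead of localising, the proof carries elements
  \<open>s, t\<close> with \<open>s + t = 1\<close> such that \<open>s x\<close> and \<open>t y\<close> lie in \<open>I\<close>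
  (\<open>prufer_comaximal_annihilators\<close>, \<open>sum_zero_comaximal_annihilators\<close>).

  For the powers, let \<open>G i j\<close> be the ideal generated by the products of entries along walks
  from \<open>i\<close> to \<open>j\<close>. Then \<open>G i j\<close> times \<open>G j k\<close> is contained in \<open>G i k\<close>, and \<open>G i i = 0\<close> since a
  closed walk contains a cycle. The matrices with ones on the diagonal and entries in
  \<open>G i j\<close> elsewhere behave like unitriangular matrices: they are closed under products and
  inverses, and they are all \<open>1\<close>-principled
  (\<open>mult_path_mat\<close>, \<open>inverse_path_mat\<close>, \<open>one_principled_path_mat\<close>).
\<close>

section \<open>Divisibility in Pruefer domains\<close>

lemma (in cring) Idl_pair_elem:
  assumes "a \<in> carrier R" "b \<in> carrier R" "x \<in> Idl {a, b}"
  obtains p q where "p \<in> carrier R" "q \<in> carrier R" "x = a \<otimes> p \<oplus> b \<otimes> q"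
proof -
  have id: "ideal (PIdl a <+> PIdl b) R"
    by (intro add_ideals cgenideal_ideal assms)
  have z: "\<zero> \<in> PIdl a" "\<zero> \<in> PIdl b"
    using assms cgenideal_ideal additive_subgroup.zero_closed ideal.axioms(1) by blast+
  have "a = a \<oplus> \<zero>" "b = \<zero> \<oplus> b" using assms by simp_all
  then have "{a, b} \<subseteq> PIdl a <+> PIdl b"
    unfolding set_add_def' using z cgenideal_self assms by blast
  then have "x \<in> PIdl a <+> PIdl b" using genideal_minimal[OF id] assms by blast
  then obtain p q where "p \<in> carrier R" "q \<in> carrier R" "x = p \<otimes> a \<oplus> q \<otimes> b"
    unfolding set_add_def' cgenideal_def by auto
  then show thesis using that[of p q] assms by (simp add: m_comm)
qed

text \<open>This is the form in which the Pruefer hypothesis is used: after localising at any prime one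
  of \<open>a\<close>, \<open>b\<close> divides the other, and \<open>s + t = 1\<close> says globally that \<open>s\<close> or \<open>t\<close> is a unit there.
  If \<open>M\<close> is inverse to the ideal \<open>(a, b)\<close>, then \<open>1 = a m + b m'\<close> with \<open>m, m'\<close> in \<open>M\<close>;
  take \<open>t = a m\<close> and \<open>s = b m'\<close>. The four products \<open>a m, a m', b m, b m'\<close> all lie in the
  domain, and \<open>s a = b (a m')\<close>, \<open>t b = a (b m)\<close>.\<close>

lemma (in domain) prufer_splitting:
  assumes prufer: "prufer_domain R" and ab: "a \<in> carrier R" "b \<in> carrier R"
  obtains s t c d where "s \<in> carrier R" "t \<in> carrier R" "c \<in> carrier R" "d \<in> carrier R"
    "s \<oplus> t = \<one>" "s \<otimes> a = b \<otimes> c" "t \<otimes> b = a \<otimes> d"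
proof (cases "a = \<zero> \<and> b = \<zero>")
  case True
  then show thesis using that[of \<one> \<zero> \<zero> \<zero>] by simp
next
  case False
  define F where "F = fraction_field R"
  define e where "e = frac_embed R"
  interpret F: field F unfolding F_def by (rule frac_field)
  interpret e: ring_hom_cring R F e
    unfolding F_def e_def
    by (intro ring_hom_cringI ring_hom_ringI2 ring_axioms is_cring frac_embed_hom
        F.ring_axioms[unfolded F_def] F.is_cring[unfolded F_def])
  have inj: "x = y" if "e x = e y" "x \<in> carrier R" "y \<in> carrier R" for x y
    using frac_embed_inj that unfolding e_def inj_on_def by blast
  have gens: "a \<in> Idl {a, b}" "b \<in> Idl {a, b}"
    using genideal_self[of "{a, b}"] ab by auto
  then have "Idl {a, b} \<noteq> {\<zero>}" using False by auto
  then have "invertible_fractional_ideal R (e ` (Idl {a, b}))"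
    using prufer ab unfolding prufer_domain_def e_def by auto
  then obtain M where M: "fractional_ideal R M" "ideal_prod F (e ` (Idl {a, b})) M = e ` carrier R"
    unfolding invertible_fractional_ideal_def F_def e_def by blast
  have sub: "additive_subgroup M F" and scal: "\<And>d x. d \<in> carrier R \<Longrightarrow> x \<in> M \<Longrightarrow> e d \<otimes>\<^bsub>F\<^esub> x \<in> M"
    using M(1) unfolding fractional_ideal_def F_def e_def by auto
  interpret M: additive_subgroup M F by (rule sub)
  have ec: "e x \<in> carrier F" if "x \<in> carrier R" for x using that by simp
  \<comment> \<open>Since \<open>M\<close> is a module over the domain, every element of the product ideal needs only two summands.\<close>
  have "\<exists>m\<in>M. \<exists>m'\<in>M. z = e a \<otimes>\<^bsub>F\<^esub> m \<oplus>\<^bsub>F\<^esub> e b \<otimes>\<^bsub>F\<^esub> m'"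
    if "z \<in> ideal_prod F (e ` (Idl {a, b})) M" for z
    using that
  proof (induction rule: ideal_prod.induct)
    case (prod i j)
    then obtain p q where pq: "p \<in> carrier R" "q \<in> carrier R" "i = e (a \<otimes> p \<oplus> b \<otimes> q)"
      using Idl_pair_elem[OF ab] by blast
    have j: "j \<in> carrier F" using prod M.a_Hcarr by blast
    have "i \<otimes>\<^bsub>F\<^esub> j = e a \<otimes>\<^bsub>F\<^esub> (e p \<otimes>\<^bsub>F\<^esub> j) \<oplus>\<^bsub>F\<^esub> e b \<otimes>\<^bsub>F\<^esub> (e q \<otimes>\<^bsub>F\<^esub> j)"
      using pq j ab by (simp add: F.l_distr F.m_assoc)
    then show ?case using scal pq prod by blast
  next
    case (sum z1 z2)
    then obtain m1 m1' m2 m2' where m: "m1 \<in> M" "m1' \<in> M" "m2 \<in> M" "m2' \<in> M"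
      "z1 = e a \<otimes>\<^bsub>F\<^esub> m1 \<oplus>\<^bsub>F\<^esub> e b \<otimes>\<^bsub>F\<^esub> m1'"
      "z2 = e a \<otimes>\<^bsub>F\<^esub> m2 \<oplus>\<^bsub>F\<^esub> e b \<otimes>\<^bsub>F\<^esub> m2'" by blast
    then have mc: "m1 \<in> carrier F" "m1' \<in> carrier F" "m2 \<in> carrier F" "m2' \<in> carrier F"
      using M.a_Hcarr by auto
    have "z1 \<oplus>\<^bsub>F\<^esub> z2 = e a \<otimes>\<^bsub>F\<^esub> (m1 \<oplus>\<^bsub>F\<^esub> m2) \<oplus>\<^bsub>F\<^esub> e b \<otimes>\<^bsub>F\<^esub> (m1' \<oplus>\<^bsub>F\<^esub> m2')"
      using mc m(5,6) ab by (simp add: F.r_distr F.a_ac)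
    then show ?case using m M.a_closed by blast
  qed
  moreover have "\<one>\<^bsub>F\<^esub> \<in> ideal_prod F (e ` (Idl {a, b})) M"
    unfolding M(2) using e.hom_one one_closed by (metis imageI)
  ultimately obtain m m' where m: "m \<in> M" "m' \<in> M"
    and one: "\<one>\<^bsub>F\<^esub> = e a \<otimes>\<^bsub>F\<^esub> m \<oplus>\<^bsub>F\<^esub> e b \<otimes>\<^bsub>F\<^esub> m'" by blast
  have mc: "m \<in> carrier F" "m' \<in> carrier F" using m M.a_Hcarr by auto
  have lift: "\<exists>c\<in>carrier R. e c = e x \<otimes>\<^bsub>F\<^esub> y" if "x \<in> {a, b}" "y \<in> M" for x y
  proof -
    have "e x \<in> e ` (Idl {a, b})" using gens that by auto
    then have "e x \<otimes>\<^bsub>F\<^esub> y \<in> e ` carrier R"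
      unfolding M(2)[symmetric] using that(2) by (rule ideal_prod.prod)
    then show ?thesis by auto
  qed
  obtain t where t: "t \<in> carrier R" "e t = e a \<otimes>\<^bsub>F\<^esub> m" using lift[of a m] m by auto
  obtain s where s: "s \<in> carrier R" "e s = e b \<otimes>\<^bsub>F\<^esub> m'" using lift[of b m'] m by auto
  obtain c where c: "c \<in> carrier R" "e c = e a \<otimes>\<^bsub>F\<^esub> m'" using lift[of a m'] m by auto
  obtain d where d: "d \<in> carrier R" "e d = e b \<otimes>\<^bsub>F\<^esub> m" using lift[of b m] m by auto
  have "s \<oplus> t = \<one>"
    by (rule inj) (use s t one mc ab in \<open>simp_all add: F.a_comm\<close>)
  moreover have "s \<otimes> a = b \<otimes> c"
    by (rule inj) (use s c mc ab in \<open>simp_all add: F.m_ac\<close>)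
  moreover have "t \<otimes> b = a \<otimes> d"
    by (rule inj) (use t d mc ab in \<open>simp_all add: F.m_ac\<close>)
  ultimately show thesis using that s t c d by blast
qed

text \<open>A Pruefer domain is integrally closed, so where \<open>w\<close> is a local unit, \<open>c\<^sup>2\<close> divides \<open>x\<^sup>2\<close> and
  this forces \<open>c\<close> to divide \<open>x\<close>. With the splitting \<open>p + q = 1\<close>
  of the pair \<open>x, c\<close>: where \<open>p\<close> is a unit, \<open>c\<close> divides \<open>x\<close>;
  where \<open>q\<close> is a unit, \<open>x y = q c\<close> for some \<open>y\<close>, and cancelling \<open>x\<^sup>2\<close> shows that \<open>y\<close> divides \<open>q\<^sup>2 w\<close>, so
  that \<open>q\<^sup>2 w x\<close> is a multiple of \<open>x y = q c\<close>.\<close>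

lemma (in domain) square_root_absorption:
  assumes prufer: "prufer_domain R" and I: "ideal I R"
    and c: "c \<in> I" and x: "x \<in> carrier R" and w: "w \<in> carrier R" and z: "z \<in> carrier R"
    and eq: "w \<otimes> (x \<otimes> x) = c \<otimes> c \<otimes> z"
  shows "w \<otimes> x \<in> I"
proof (cases "x = \<zero>")
  case True
  then show ?thesis using w I by (simp add: additive_subgroup.zero_closed ideal.axioms(1))
next
  case False
  interpret I: ideal I R by (rule I)
  have cc: "c \<in> carrier R" using c I.Icarr by blast
  obtain p q y y' where pq: "p \<in> carrier R" "q \<in> carrier R" "y' \<in> carrier R" "y \<in> carrier R"
    "p \<oplus> q = \<one>" "p \<otimes> x = c \<otimes> y'" "q \<otimes> c = x \<otimes> y"
    using prufer_splitting[OF prufer x cc] by blast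
  have "(x \<otimes> x) \<otimes> (q \<otimes> q \<otimes> w) = q \<otimes> q \<otimes> (w \<otimes> (x \<otimes> x))"
    using x pq w by (simp add: m_ac)
  also have "\<dots> = (q \<otimes> c) \<otimes> (q \<otimes> c) \<otimes> z"
    unfolding eq using cc pq(1-4) z by (simp add: m_ac)
  also have "\<dots> = (x \<otimes> x) \<otimes> (y \<otimes> y \<otimes> z)"
    unfolding pq(7) using x pq(1-4) z by (simp add: m_ac)
  finally have qw: "q \<otimes> q \<otimes> w = y \<otimes> y \<otimes> z"
    using m_lcancel[of "x \<otimes> x" "q \<otimes> q \<otimes> w" "y \<otimes> y \<otimes> z"] False x pq(2,4) w z integral[of x x]
    by auto
  have "x \<otimes> y \<in> I" using I.I_l_closed[OF c pq(2)] pq(7) by simp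
  then have "q \<otimes> q \<otimes> w \<otimes> x \<in> I"
    unfolding qw using I.I_l_closed[of "x \<otimes> y" "y \<otimes> z"] x pq z by (simp add: m_ac)
  moreover have px: "p \<otimes> x \<in> I" unfolding pq(6) using I.I_r_closed[OF c pq(3)] .
  \<comment> \<open>This is \<open>1 = p + q p + q\<^sup>2\<close>, multiplied by \<open>w x\<close>.\<close>
  moreover have "w \<otimes> x = (w \<oplus> w \<otimes> q) \<otimes> (p \<otimes> x) \<oplus> q \<otimes> q \<otimes> w \<otimes> x"
  proof -
    have wx: "p \<otimes> (w \<otimes> x) \<oplus> q \<otimes> (w \<otimes> x) = w \<otimes> x"
      using l_distr[OF pq(1,2), of "w \<otimes> x"] pq(5) w x by simp
    have "(w \<oplus> w \<otimes> q) \<otimes> (p \<otimes> x) \<oplus> q \<otimes> q \<otimes> w \<otimes> x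
        = p \<otimes> (w \<otimes> x) \<oplus> q \<otimes> (p \<otimes> (w \<otimes> x) \<oplus> q \<otimes> (w \<otimes> x))"
      using pq(1,2) w x by algebra
    then show ?thesis unfolding wx by simp
  qed
  moreover have "(w \<oplus> w \<otimes> q) \<otimes> (p \<otimes> x) \<in> I"
    using I.I_l_closed[OF px] w pq by simp
  ultimately show ?thesis using I.a_closed by simp
qed

text \<open>If a product of two elements is divisible by a product of two elements of \<open>I\<close>, then
  locally one of the factors lies in \<open>I\<close>. Where \<open>y\<close> divides \<open>x\<close> and \<open>d\<close> divides \<open>c\<close>, the
  square \<open>d\<^sup>2\<close> divides \<open>x y\<close> and hence \<open>x\<^sup>2\<close>; the other three cases are symmetric.\<close>

lemma (in domain) prufer_comaximal_annihilators:
  assumes prufer: "prufer_domain R" and I: "ideal I R"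
    and c: "c \<in> I" "d \<in> I" and r: "r \<in> carrier R"
    and x: "x \<in> carrier R" and y: "y \<in> carrier R"
    and eq: "x \<otimes> y = c \<otimes> d \<otimes> r"
  obtains s t where "s \<in> carrier R" "t \<in> carrier R" "s \<oplus> t = \<one>" "s \<otimes> x \<in> I" "t \<otimes> y \<in> I"
proof -
  interpret I: ideal I R by (rule I)
  have cc: "c \<in> carrier R" "d \<in> carrier R" using c I.Icarr by auto
  obtain u v h k where uv: "u \<in> carrier R" "v \<in> carrier R" "h \<in> carrier R" "k \<in> carrier R"
    "u \<oplus> v = \<one>" "u \<otimes> c = d \<otimes> h" "v \<otimes> d = c \<otimes> k"
    using prufer_splitting[OF prufer cc] by blast
  have half: "s' \<otimes> x' \<in> I"
    if *: "x' \<in> carrier R" "y' \<in> carrier R" "s' \<in> carrier R" "a \<in> carrier R"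
      "s' \<otimes> x' = y' \<otimes> a" "x' \<otimes> y' = c \<otimes> d \<otimes> r" for x' y' s' a
  proof -
    have sq: "s' \<otimes> (x' \<otimes> x') = c \<otimes> d \<otimes> r \<otimes> a"
    proof -
      have "s' \<otimes> (x' \<otimes> x') = (s' \<otimes> x') \<otimes> x'" using *(1-4) by (simp add: m_ac)
      also have "\<dots> = x' \<otimes> y' \<otimes> a" unfolding *(5) using *(1-4) by (simp add: m_ac)
      finally show ?thesis unfolding *(6) .
    qed
    have "(u \<otimes> s') \<otimes> (x' \<otimes> x') = u \<otimes> (c \<otimes> d \<otimes> r \<otimes> a)"
      unfolding sq[symmetric] using *(1-4) uv(1-4) by (simp add: m_ac)
    also have "\<dots> = (u \<otimes> c) \<otimes> (d \<otimes> r \<otimes> a)" using *(1-4) uv(1-4) cc r by (simp add: m_ac)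
    also have "\<dots> = d \<otimes> d \<otimes> (h \<otimes> r \<otimes> a)" unfolding uv(6) using *(1-4) uv(1-4) cc r by (simp add: m_ac)
    finally have 1: "(u \<otimes> s') \<otimes> x' \<in> I"
      by (intro square_root_absorption[OF prufer I c(2), of x' "u \<otimes> s'" "h \<otimes> r \<otimes> a"]) (use * uv r in auto)
    have "(v \<otimes> s') \<otimes> (x' \<otimes> x') = v \<otimes> (c \<otimes> d \<otimes> r \<otimes> a)"
      unfolding sq[symmetric] using *(1-4) uv(1-4) by (simp add: m_ac)
    also have "\<dots> = (v \<otimes> d) \<otimes> (c \<otimes> r \<otimes> a)" using *(1-4) uv(1-4) cc r by (simp add: m_ac)
    also have "\<dots> = c \<otimes> c \<otimes> (k \<otimes> r \<otimes> a)" unfolding uv(7) using *(1-4) uv(1-4) cc r by (simp add: m_ac)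
    finally have 2: "(v \<otimes> s') \<otimes> x' \<in> I"
      by (intro square_root_absorption[OF prufer I c(1), of x' "v \<otimes> s'" "k \<otimes> r \<otimes> a"]) (use * uv r in auto)
    have "s' \<otimes> x' = (u \<oplus> v) \<otimes> (s' \<otimes> x')" using * uv by simp
    also have "\<dots> = (u \<otimes> s') \<otimes> x' \<oplus> (v \<otimes> s') \<otimes> x'"
      unfolding l_distr[OF uv(1,2) m_closed[OF *(3,1)]] using * uv by (simp add: m_assoc)
    finally show ?thesis using 1 2 I.a_closed by simp
  qed
  obtain s t a b where st: "s \<in> carrier R" "t \<in> carrier R" "a \<in> carrier R" "b \<in> carrier R"
    "s \<oplus> t = \<one>" "s \<otimes> x = y \<otimes> a" "t \<otimes> y = x \<otimes> b"
    using prufer_splitting[OF prufer x y] by blast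
  have "s \<otimes> x \<in> I" using half[OF x y st(1,3,6) eq] .
  moreover have "t \<otimes> y \<in> I" using half[OF y x st(2,4,7)] eq x y by (simp add: m_comm)
  ultimately show thesis using that st by blast
qed

text \<open>Locally at most one of the elements \<open>y p\<close> is nonzero, and then their sum cannot vanish
  unless that one vanishes too. Changing the sign of a \<open>y p\<close> preserves its annihilator, so the
  signs of the terms of a determinant need no attention.\<close>

lemma (in cring) sum_zero_comaximal_annihilators:
  assumes fin: "finite P" and y: "y \<in> P \<rightarrow> carrier R"
    and sum: "(\<Oplus>p\<in>P. y p) = \<zero>"
    and comax: "\<And>p q. p \<in> P \<Longrightarrow> q \<in> P \<Longrightarrow> p \<noteq> q \<Longrightarrow>
       \<exists>s\<in>carrier R. \<exists>t\<in>carrier R. s \<oplus> t = \<one> \<and> s \<otimes> y p = \<zero> \<and> t \<otimes> y q = \<zero>"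
    and p: "p \<in> P"
  shows "y p = \<zero>"
proof -
  have yc: "\<And>q. q \<in> P \<Longrightarrow> y q \<in> carrier R" using y by auto
  have "\<exists>s\<in>carrier R. \<exists>t\<in>carrier R. s \<oplus> t = \<one> \<and> s \<otimes> y p = \<zero> \<and> (\<forall>q\<in>F. t \<otimes> y q = \<zero>)"
    if "finite F" "F \<subseteq> P - {p}" for F
    using that
  proof (induction F rule: finite_induct)
    case empty
    then show ?case using yc[OF p] by (intro bexI[of _ \<zero>] bexI[of _ \<one>]) auto
  next
    case (insert q F)
    then obtain s t where st: "s \<in> carrier R" "t \<in> carrier R" "s \<oplus> t = \<one>" "s \<otimes> y p = \<zero>"
      "\<forall>q\<in>F. t \<otimes> y q = \<zero>" by auto
    obtain s' t' where st': "s' \<in> carrier R" "t' \<in> carrier R" "s' \<oplus> t' = \<one>" "s' \<otimes> y p = \<zero>"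
      "t' \<otimes> y q = \<zero>" using comax[of p q] p insert.prems by blast
    have F: "\<And>q. q \<in> F \<Longrightarrow> y q \<in> carrier R" and q: "y q \<in> carrier R"
      using insert.prems yc by auto
    \<comment> \<open>The new pair comes from \<open>1 = s + t (s' + t')\<close>.\<close>
    have "(s \<oplus> t \<otimes> s') \<oplus> t \<otimes> t' = s \<oplus> t \<otimes> (s' \<oplus> t')"
      using st(1,2) st'(1,2) by algebra
    then have "(s \<oplus> t \<otimes> s') \<oplus> t \<otimes> t' = \<one>" using st st' by simp
    moreover have "(s \<oplus> t \<otimes> s') \<otimes> y p = \<zero>"
      using st st' yc[OF p] by (simp add: l_distr m_assoc)
    moreover have "(t \<otimes> t') \<otimes> y q' = \<zero>" if "q' \<in> insert q F" for q'
    proof (cases "q' = q")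
      case True
      then show ?thesis using st st' q by (simp add: m_assoc)
    next
      case False
      then have "(t \<otimes> t') \<otimes> y q' = t' \<otimes> (t \<otimes> y q')" using st st' F that by (simp add: m_ac)
      then show ?thesis using st st' False that by simp
    qed
    ultimately show ?case using st st'
      by (intro bexI[of _ "s \<oplus> t \<otimes> s'"] bexI[of _ "t \<otimes> t'"]) auto
  qed
  from this[of "P - {p}"] obtain s t where st: "s \<in> carrier R" "t \<in> carrier R" "s \<oplus> t = \<one>"
    "s \<otimes> y p = \<zero>" "\<forall>q\<in>P - {p}. t \<otimes> y q = \<zero>" using fin by auto
  have "\<zero> = t \<otimes> (\<Oplus>q\<in>insert p (P - {p}). y q)"
    using sum st p by (simp add: insert_absorb)
  also have "\<dots> = (\<Oplus>q\<in>insert p (P - {p}). t \<otimes> y q)"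
    using fin st yc p by (intro finsum_rdistr) auto
  also have "\<dots> = t \<otimes> y p \<oplus> (\<Oplus>q\<in>P - {p}. t \<otimes> y q)"
    using fin st yc p by (intro finsum_insert) auto
  also have "(\<Oplus>q\<in>P - {p}. t \<otimes> y q) = \<zero>"
    using st by (auto intro!: add.finprod_one_eqI)
  finally have "t \<otimes> y p = \<zero>" using st yc[OF p] by simp
  moreover have "y p = s \<otimes> y p \<oplus> t \<otimes> y p"
    using st yc[OF p] by (metis l_distr l_one)
  ultimately show ?thesis using st(4) by simp
qed


section \<open>Edge multisets and their weights\<close>

text \<open>Products of matrix entries along cycles are handled as monomials: a multiset of edges
  records the exponents, so that a rearrangement of cycles is an equation between multisets.\<close>

definition edge_weight :: "('a, 'b) ring_scheme \<Rightarrow> ('e \<Rightarrow> 'a) \<Rightarrow> 'e multiset \<Rightarrow> 'a" where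
  "edge_weight R a E = (\<Otimes>\<^bsub>R\<^esub>e\<in>set_mset E. a e [^]\<^bsub>R\<^esub> count E e)"

definition graph_edges :: "('i \<Rightarrow> 'j) \<Rightarrow> 'i set \<Rightarrow> ('i \<times> 'j) multiset" where
  "graph_edges f S = image_mset (\<lambda>i. (i, f i)) (mset_set S)"

definition balanced :: "('i \<times> 'i) multiset \<Rightarrow> bool" where
  "balanced E \<longleftrightarrow> image_mset fst E = image_mset snd E"

text \<open>A minimal nonempty subset closed under \<open>f\<close> is mapped onto itself. It plays the role of a
  cycle of \<open>f\<close>, of which only the bijectivity is ever used.\<close>

lemma exists_bij_on_subset:
  assumes "finite V" "V \<noteq> {}" "f ` V \<subseteq> V"
  obtains T where "T \<subseteq> V" "T \<noteq> {}" "bij_betw f T T"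
proof -
  define P where "P T \<longleftrightarrow> T \<subseteq> V \<and> T \<noteq> {} \<and> f ` T \<subseteq> T" for T
  have "P V" using assms by (simp add: P_def)
  then obtain T where T: "P T" "\<And>U. card U < card T \<Longrightarrow> \<not> P U"
    using measure_induct_rule[of card "\<lambda>T. \<not> P T" V] by blast
  have fin: "finite T" using T assms(1) finite_subset by (auto simp: P_def)
  have "P (f ` T)" using T(1) by (auto simp: P_def)
  then have "f ` T = T"
    using T psubset_card_mono[OF fin, of "f ` T"] by (auto simp: P_def psubset_eq)
  then have "bij_betw f T T"
    using fin by (simp add: bij_betw_def eq_card_imp_inj_on)
  then show thesis using that T(1) by (auto simp: P_def)
qed

lemma size_graph_edges [simp]: "size (graph_edges f S) = card S"
  by (simp add: graph_edges_def)

lemma set_graph_edges: "finite S \<Longrightarrow> set_mset (graph_edges f S) = (\<lambda>i. (i, f i)) ` S"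
  by (simp add: graph_edges_def)

lemma balanced_graph_edges:
  assumes "bij_betw f T T"
  shows "balanced (graph_edges f T)"
proof -
  have "image_mset f (mset_set T) = mset_set T"
    using assms by (simp add: bij_betw_def image_mset_mset_set)
  then show ?thesis by (simp add: balanced_def graph_edges_def multiset.map_comp comp_def)
qed

lemma balanced_diff:
  assumes "balanced E" "balanced F" "F \<subseteq># E"
  shows "balanced (E - F)"
  using assms by (simp add: balanced_def image_mset_Diff)

lemma graph_edges_subset:
  assumes "finite T" "\<And>i. i \<in> T \<Longrightarrow> (i, f i) \<in># E"
  shows "graph_edges f T \<subseteq># E"
proof -
  have "graph_edges f T = mset_set ((\<lambda>i. (i, f i)) ` T)"
    unfolding graph_edges_def by (rule image_mset_mset_set) (auto simp: inj_on_def)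
  also have "\<dots> \<subseteq># mset_set (set_mset E)"
    using assms by (intro subset_imp_msubset_mset_set) auto
  also have "\<dots> \<subseteq># E" by (rule mset_set_set_mset_msubset)
  finally show ?thesis .
qed

text \<open>Every vertex with an outgoing edge also has an incoming one, and conversely. Following a
  chosen outgoing edge therefore never leaves the finite vertex set, and a cycle is reached.\<close>

lemma balanced_contains_graph_edges:
  assumes "balanced E" "E \<noteq> {#}"
  obtains T f where "finite T" "T \<noteq> {}" "T \<subseteq> fst ` set_mset E" "bij_betw f T T"
    "graph_edges f T \<subseteq># E"
proof -
  define V where "V = fst ` set_mset E"
  have V: "V = snd ` set_mset E"
    using arg_cong[OF assms(1)[unfolded balanced_def], of set_mset] by (simp add: V_def)
  have "\<forall>i\<in>V. \<exists>j. (i, j) \<in># E" by (auto simp: V_def)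
  then obtain f where f: "\<And>i. i \<in> V \<Longrightarrow> (i, f i) \<in># E" by metis
  have "f ` V \<subseteq> V" using f by (force simp: V)
  moreover have "finite V" "V \<noteq> {}" using assms(2) by (auto simp: V_def)
  ultimately obtain T where T: "T \<subseteq> V" "T \<noteq> {}" "bij_betw f T T"
    using exists_bij_on_subset[of V f] by blast
  have fin: "finite T" using T(1) finite_subset by (auto simp: V_def)
  show thesis
    using that[OF fin T(2) _ T(3) graph_edges_subset[OF fin]] T(1) f by (auto simp: V_def)
qed

text \<open>The combinatorial core. The union of the graphs of two different bijections on \<open>k\<close> points
  contains two disjoint subgraphs of bijections on fewer points. The first comes from a
  self-map with edges in the union that is not injective, so that no bijective restriction of it
  uses all points. What remains is balanced with more than \<open>k\<close> edges; if it yields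
  a bijection \<open>g\<close> on all points, removing \<open>g\<close> leaves fewer than \<open>k\<close> edges, but at least one, and
  these contain the second subgraph.\<close>

lemma two_bijections_contain_two_smaller:
  assumes fin: "finite S" and \<sigma>: "bij_betw \<sigma> S S" and \<tau>: "bij_betw \<tau> S S"
    and v: "v \<in> S" "\<sigma> v \<noteq> \<tau> v"
  obtains T f U g E where "T \<subset> S" "T \<noteq> {}" "bij_betw f T T" "U \<subset> S" "U \<noteq> {}" "bij_betw g U U"
    "graph_edges \<sigma> S + graph_edges \<tau> S = graph_edges f T + graph_edges g U + E"
proof -
  define E where "E = graph_edges \<sigma> S + graph_edges \<tau> S"
  have setE: "set_mset E = (\<lambda>i. (i, \<sigma> i)) ` S \<union> (\<lambda>i. (i, \<tau> i)) ` S"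
    using fin by (simp add: E_def set_graph_edges)
  have balE: "balanced E"
    using balanced_graph_edges[OF \<sigma>] balanced_graph_edges[OF \<tau>] by (simp add: E_def balanced_def)
  define f where "f = \<sigma>(v := \<tau> v)"
  have "f ` S \<subseteq> S" using \<sigma> \<tau> by (auto simp: f_def bij_betw_def)
  then obtain T where T: "T \<subseteq> S" "T \<noteq> {}" "bij_betw f T T"
    using exists_bij_on_subset[of S f] fin v by auto
  \<comment> \<open>Redirecting \<open>v\<close> makes the value \<open>\<tau> v\<close> occur twice.\<close>
  obtain u where u: "u \<in> S" "\<sigma> u = \<tau> v" using \<sigma> \<tau> v by (metis bij_betwE bij_betw_imp_surj_on imageE)
  have "u \<noteq> v" "f u = f v" using u v by (auto simp: f_def)
  then have "\<not> inj_on f S" using u v by (auto simp: inj_on_def)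
  then have TS: "T \<subset> S" using T by (auto simp: bij_betw_def)
  have finT: "finite T" using T fin finite_subset by blast
  have fE: "graph_edges f T \<subseteq># E"
    by (rule graph_edges_subset[OF finT]) (use T in \<open>auto simp: setE f_def\<close>)
  define E1 where "E1 = E - graph_edges f T"
  have E: "E = graph_edges f T + E1" using fE by (simp add: E1_def)
  have cardT: "card T < card S" using TS fin psubset_card_mono by blast
  have "size E = card S + card S" by (simp add: E_def)
  then have size1: "card T + size E1 = card S + card S" unfolding E by simp
  have bal1: "balanced E1"
    unfolding E1_def by (rule balanced_diff[OF balE balanced_graph_edges[OF T(3)] fE])
  have "E1 \<noteq> {#}" using size1 cardT by auto
  then obtain U g where U: "finite U" "U \<noteq> {}" "U \<subseteq> fst ` set_mset E1" "bij_betw g U U"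
    "graph_edges g U \<subseteq># E1"
    using balanced_contains_graph_edges[OF bal1] by metis
  define E2 where "E2 = E1 - graph_edges g U"
  have E1: "E1 = graph_edges g U + E2" using U by (simp add: E2_def)
  have subS: "fst ` set_mset E \<subseteq> S" by (auto simp: setE)
  have "set_mset E1 \<subseteq> set_mset E" unfolding E by simp
  then have US: "U \<subseteq> S" using U(3) subS by blast
  show thesis
  proof (cases "U = S")
    case False
    then show thesis
      using that[OF TS T(2,3) _ U(2,4), of E2] US unfolding E_def[symmetric]
      by (auto simp: E E1)
  next
    case True
    have bal2: "balanced E2"
      unfolding E2_def by (rule balanced_diff[OF bal1 balanced_graph_edges[OF U(4)] U(5)])
    have size2: "card T + size E2 = card S" using size1 unfolding E1 True by simp
    then have "E2 \<noteq> {#}" using cardT by auto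
    then obtain W h where W: "finite W" "W \<noteq> {}" "W \<subseteq> fst ` set_mset E2" "bij_betw h W W"
      "graph_edges h W \<subseteq># E2"
      using balanced_contains_graph_edges[OF bal2] by metis
    define E3 where "E3 = E2 - graph_edges h W"
    have E2: "E2 = graph_edges h W + E3" using W by (simp add: E3_def)
    have "card T \<noteq> 0" using T(2) finT by simp
    moreover have "card T + (card W + size E3) = card S" using size2 unfolding E2 by simp
    ultimately have "card W < card S" by linarith
    moreover have "set_mset E2 \<subseteq> set_mset E" unfolding E E1 by auto
    then have "W \<subseteq> S" using W(3) subS by blast
    ultimately have WS: "W \<subset> S" by auto
    have "E = graph_edges f T + graph_edges h W + (graph_edges g U + E3)"
      by (simp add: E E1 E2)
    then show thesis using that[OF TS T(2,3) WS W(2,4)] unfolding E_def by blast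
  qed
qed

context cring
begin

lemma edge_weight_superset:
  assumes "finite V" "set_mset E \<subseteq> V" "\<And>e. e \<in> V \<Longrightarrow> a e \<in> carrier R"
  shows "edge_weight R a E = (\<Otimes>e\<in>V. a e [^] count E e)"
  unfolding edge_weight_def
  by (rule finprod_mono_neutral_cong_left) (use assms in \<open>auto simp: not_in_iff\<close>)

lemma edge_weight_closed [intro]:
  "(\<And>e. e \<in># E \<Longrightarrow> a e \<in> carrier R) \<Longrightarrow> edge_weight R a E \<in> carrier R"
  unfolding edge_weight_def by (intro finprod_closed) auto

lemma edge_weight_single: "a e \<in> carrier R \<Longrightarrow> edge_weight R a {#e#} = a e"
  by (simp add: edge_weight_def)

lemma edge_weight_union:
  assumes "\<And>e. e \<in># E + F \<Longrightarrow> a e \<in> carrier R"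
  shows "edge_weight R a (E + F) = edge_weight R a E \<otimes> edge_weight R a F"
proof -
  let ?V = "set_mset (E + F)"
  have "edge_weight R a (E + F) = (\<Otimes>e\<in>?V. a e [^] count E e \<otimes> a e [^] count F e)"
    unfolding edge_weight_def using assms by (intro finprod_cong') (auto simp: nat_pow_mult)
  also have "\<dots> = (\<Otimes>e\<in>?V. a e [^] count E e) \<otimes> (\<Otimes>e\<in>?V. a e [^] count F e)"
    using assms by (intro finprod_multf) auto
  also have "\<dots> = edge_weight R a E \<otimes> edge_weight R a F"
    using edge_weight_superset[of ?V E a] edge_weight_superset[of ?V F a] assms by auto
  finally show ?thesis .
qed

lemma edge_weight_graph_edges:
  assumes "finite S" "\<And>i. i \<in> S \<Longrightarrow> a (i, f i) \<in> carrier R"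
  shows "edge_weight R a (graph_edges f S) = (\<Otimes>i\<in>S. a (i, f i))"
  using assms
proof (induction S rule: finite_induct)
  case empty
  then show ?case by (simp add: graph_edges_def edge_weight_def)
next
  case (insert x S)
  have "graph_edges f (insert x S) = {#(x, f x)#} + graph_edges f S"
    using insert by (simp add: graph_edges_def)
  then have "edge_weight R a (graph_edges f (insert x S))
    = edge_weight R a {#(x, f x)#} \<otimes> edge_weight R a (graph_edges f S)"
    using insert by (simp only:) (rule edge_weight_union, auto simp: set_graph_edges)
  then show ?case using insert by (simp add: edge_weight_single Pi_def)
qed

end


section \<open>Vanishing of cycle products\<close>

lemma (in ring_hom_cring) hom_edge_weight:
  assumes "\<And>e. e \<in># E \<Longrightarrow> a e \<in> carrier R"
  shows "h (edge_weight R a E) = edge_weight S (\<lambda>e. h (a e)) E"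
proof -
  have pow: "h (x [^] k) = h x [^]\<^bsub>S\<^esub> k" if "x \<in> carrier R" for x and k :: nat
    using that by (induction k) auto
  have "h (edge_weight R a E) = (\<Otimes>\<^bsub>S\<^esub>e\<in>set_mset E. h (a e [^] count E e))"
    unfolding edge_weight_def using assms by (subst hom_finprod) (auto simp: comp_def)
  also have "\<dots> = edge_weight S (\<lambda>e. h (a e)) E"
    unfolding edge_weight_def using assms by (intro S.finprod_cong') (auto simp: pow)
  finally show ?thesis .
qed

lemma (in ring) quotient_coset_zero_iff:
  assumes "ideal I R" "x \<in> carrier R"
  shows "I +> x = \<zero>\<^bsub>R Quot I\<^esub> \<longleftrightarrow> x \<in> I"
proof
  have zero: "\<zero>\<^bsub>R Quot I\<^esub> = I" by (simp add: FactRing_def)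
  show "x \<in> I" if "I +> x = \<zero>\<^bsub>R Quot I\<^esub>"
    using ideal.rcos_const_imp_mem[OF assms] that unfolding zero by blast
  show "I +> x = \<zero>\<^bsub>R Quot I\<^esub>" if "x \<in> I" unfolding zero by (rule a_rcos_zero[OF assms(1) that])
qed

text \<open>Divisibility arguments need cancellation, which is available in the domain but not in its
  quotient. The monomials are therefore lifted: \<open>M + N = E + F + G\<close> becomes an equation between
  products of lifts, in which the lifted weights of \<open>E\<close> and \<open>F\<close> lie in \<open>I\<close>.\<close>

lemma (in domain) quotient_weights_comaximal_annihilators:
  fixes I :: "'a set" and A :: "'e \<Rightarrow> 'a set"
  defines "Q \<equiv> R Quot I"
  assumes prufer: "prufer_domain R" and I: "ideal I R"
    and A: "\<And>e. e \<in># M + N \<Longrightarrow> A e \<in> carrier Q"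
    and eq: "M + N = E + F + G"
    and zero: "edge_weight Q A E = \<zero>\<^bsub>Q\<^esub>" "edge_weight Q A F = \<zero>\<^bsub>Q\<^esub>"
  shows "\<exists>s\<in>carrier Q. \<exists>t\<in>carrier Q. s \<oplus>\<^bsub>Q\<^esub> t = \<one>\<^bsub>Q\<^esub> \<and>
     s \<otimes>\<^bsub>Q\<^esub> edge_weight Q A M = \<zero>\<^bsub>Q\<^esub> \<and> t \<otimes>\<^bsub>Q\<^esub> edge_weight Q A N = \<zero>\<^bsub>Q\<^esub>"
proof -
  interpret I: ideal I R by (rule I)
  interpret h: ring_hom_cring R Q "(+>) I"
    unfolding Q_def by (rule I.rcos_ring_hom_cring[OF is_cring])
  have ker: "I +> x = \<zero>\<^bsub>Q\<^esub> \<longleftrightarrow> x \<in> I" if "x \<in> carrier R" for x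
    unfolding Q_def by (rule quotient_coset_zero_iff[OF I that])
  have "\<exists>x\<in>carrier R. I +> x = A e" if "e \<in># M + N" for e
    using A[OF that] unfolding Q_def FactRing_def A_RCOSETS_def' by auto
  then obtain a where a: "\<And>e. e \<in># M + N \<Longrightarrow> a e \<in> carrier R" "\<And>e. e \<in># M + N \<Longrightarrow> I +> a e = A e"
    by metis
  have wc: "edge_weight R a W \<in> carrier R" if "W \<subseteq># M + N" for W
    using a(1) that by (intro edge_weight_closed) (auto dest: mset_subset_eqD)
  have w: "I +> edge_weight R a W = edge_weight Q A W" if "W \<subseteq># M + N" for W
  proof -
    have e: "e \<in># M + N" if "e \<in># W" for e using that \<open>W \<subseteq># M + N\<close> by (rule mset_subset_eqD[rotated])
    have "I +> edge_weight R a W = edge_weight Q (\<lambda>e. I +> a e) W"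
      by (rule h.hom_edge_weight) (use a(1) e in blast)
    also have "\<dots> = edge_weight Q A W"
      unfolding edge_weight_def using a e A by (intro h.S.finprod_cong') auto
    finally show ?thesis .
  qed
  have sub: "M \<subseteq># M + N" "N \<subseteq># M + N" "E \<subseteq># M + N" "F \<subseteq># M + N" "G \<subseteq># M + N"
    using mset_subset_eq_add_left mset_subset_eq_add_right unfolding eq
    by (auto simp: eq[symmetric]) (auto simp: eq subseteq_mset_def)
  have EF: "edge_weight R a E \<in> I" "edge_weight R a F \<in> I"
    using zero w[OF sub(3)] w[OF sub(4)] ker wc sub by auto
  have "edge_weight R a M \<otimes> edge_weight R a N = edge_weight R a (E + F + G)"
    unfolding eq[symmetric] using a(1) by (intro edge_weight_union[symmetric]) auto
  also have "\<dots> = edge_weight R a E \<otimes> edge_weight R a F \<otimes> edge_weight R a G"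
    using a(1) unfolding eq by (subst edge_weight_union, blast, subst edge_weight_union) auto
  finally obtain s t where st: "s \<in> carrier R" "t \<in> carrier R" "s \<oplus> t = \<one>"
    "s \<otimes> edge_weight R a M \<in> I" "t \<otimes> edge_weight R a N \<in> I"
    using prufer_comaximal_annihilators[OF prufer I EF wc[OF sub(5)] wc[OF sub(1)] wc[OF sub(2)]] by blast
  show ?thesis
  proof (intro bexI conjI)
    show "(I +> s) \<oplus>\<^bsub>Q\<^esub> (I +> t) = \<one>\<^bsub>Q\<^esub>"
      using st by (metis h.hom_add h.hom_one)
    show "(I +> s) \<otimes>\<^bsub>Q\<^esub> edge_weight Q A M = \<zero>\<^bsub>Q\<^esub>"
      unfolding w[OF sub(1), symmetric] using st wc[OF sub(1)] ker by (simp flip: h.hom_mult)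
    show "(I +> t) \<otimes>\<^bsub>Q\<^esub> edge_weight Q A N = \<zero>\<^bsub>Q\<^esub>"
      unfolding w[OF sub(2), symmetric] using st wc[OF sub(2)] ker by (simp flip: h.hom_mult)
  qed (use st in auto)
qed

text \<open>The bijections range over disjoint unions of cycles without loops. As every such union
  contains a single cycle, and single cycles are a special case, the condition is that the
  product of the entries along every cycle of length at least two is zero.\<close>

definition cycles_vanish :: "('a, 'b) ring_scheme \<Rightarrow> 'i set \<Rightarrow> ('i \<times> 'i \<Rightarrow> 'a) \<Rightarrow> bool" where
  "cycles_vanish R S A \<longleftrightarrow> (\<forall>T f. T \<subseteq> S \<and> T \<noteq> {} \<and> bij_betw f T T \<and> (\<forall>i\<in>T. f i \<noteq> i) \<longrightarrow>
     (\<Otimes>\<^bsub>R\<^esub>i\<in>T. A (i, f i)) = \<zero>\<^bsub>R\<^esub>)"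

context cring
begin

lemma finprod_zero_subset:
  assumes "finite S" "T \<subseteq> S" "f \<in> S \<rightarrow> carrier R" "(\<Otimes>i\<in>T. f i) = \<zero>"
  shows "(\<Otimes>i\<in>S. f i) = \<zero>"
proof -
  have "(\<Otimes>i\<in>T \<union> (S - T). f i) = (\<Otimes>i\<in>T. f i) \<otimes> (\<Otimes>i\<in>S - T. f i)"
    using assms finite_subset by (intro finprod_Un_disjoint) auto
  moreover have "T \<union> (S - T) = S" using assms by auto
  moreover have "(\<Otimes>i\<in>S - T. f i) \<in> carrier R" using assms by (intro finprod_closed) auto
  ultimately show ?thesis using assms(4) by simp
qed

lemma permutation_product_zero:
  assumes fin: "finite S" and A: "\<And>i j. i \<in> S \<Longrightarrow> j \<in> S \<Longrightarrow> A (i, j) \<in> carrier R"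
    and p: "p permutes S" and U: "U = {i\<in>S. p i \<noteq> i}" and van: "cycles_vanish R U A"
    and ne: "U \<noteq> {}"
  shows "(\<Otimes>i\<in>S. A (i, p i)) = \<zero>"
proof -
  have inj: "inj p" using p permutes_inj by blast
  have "p ` U \<subseteq> U"
    using permutes_in_image[OF p] inj by (auto simp: U inj_eq)
  moreover have "finite U" using fin U by simp
  moreover have "inj_on p U" using inj inj_on_subset by blast
  ultimately have "bij_betw p U U" by (simp add: bij_betw_def endo_inj_surj)
  then have "(\<Otimes>i\<in>U. A (i, p i)) = \<zero>"
    using van ne unfolding cycles_vanish_def U by blast
  then show ?thesis
    using fin U A permutes_in_image[OF p] by (intro finprod_zero_subset[of S U]) auto
qed

lemma mat_det_eq_sum:
  assumes "finite S" "\<And>i j. i \<in> S \<Longrightarrow> j \<in> S \<Longrightarrow> A (i, j) \<in> carrier R"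
    and diag: "\<And>i. i \<in> S \<Longrightarrow> A (i, i) = \<one>"
  shows "mat_det R S (principal_submatrix A S) = \<one> \<oplus> (\<Oplus>p\<in>{p. p permutes S} - {id}.
     if evenperm p then (\<Otimes>i\<in>S. A (i, p i)) else \<ominus> (\<Otimes>i\<in>S. A (i, p i)))"
proof -
  let ?P = "{p. p permutes S} - {id}"
  let ?y = "\<lambda>p. if evenperm p then (\<Otimes>i\<in>S. A (i, p i)) else \<ominus> (\<Otimes>i\<in>S. A (i, p i))"
  have pS: "p i \<in> S" if "p permutes S" "i \<in> S" for p i using that permutes_in_image by metis
  have prod_eq: "(\<Otimes>i\<in>S. principal_submatrix A S (i, p i)) = (\<Otimes>i\<in>S. A (i, p i))"
    if "p permutes S" for p
    using assms pS[OF that] by (intro finprod_cong') (auto simp: principal_submatrix_def)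
  have c: "(\<Otimes>i\<in>S. A (i, p i)) \<in> carrier R" if "p permutes S" for p
    using assms pS[OF that] by (intro finprod_closed) auto
  have P: "{p. p permutes S} = insert id ?P" using permutes_id by auto
  have "mat_det R S (principal_submatrix A S) = (\<Oplus>p\<in>{p. p permutes S}. ?y p)"
    unfolding mat_det_def using c by (intro finsum_cong') (auto simp: prod_eq)
  also have "\<dots> = ?y id \<oplus> (\<Oplus>p\<in>?P. ?y p)"
    by (subst P, rule finsum_insert) (use c[OF permutes_id] c assms(1) in \<open>auto simp: finite_permutations\<close>)
  also have "?y id = \<one>"
    using diag by (auto intro!: finprod_one_eqI)
  finally show ?thesis .
qed

end

text \<open>Induction on \<open>T\<close>. The determinant of the submatrix on \<open>T\<close> is \<open>1\<close> plus the signed products over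
  the other permutations of \<open>T\<close>, so these products sum to zero. A permutation with
  a fixed point restricts to the proper subset that it moves, and its product is zero by
  induction. For two different permutations without fixed points, the product of
  their monomials contains two smaller cycle products; both are zero by induction, which makes the
  annihilators of the two monomials comaximal. Hence every product over a nonidentical permutation is zero.\<close>

lemma (in domain) prufer_quotient_cycles_vanish:
  fixes I :: "'a set" and A :: "'i \<times> 'i \<Rightarrow> 'a set"
  defines "Q \<equiv> R Quot I"
  assumes prufer: "prufer_domain R" and I: "ideal I R" and fin: "finite S"
    and A: "\<And>i j. i \<in> S \<Longrightarrow> j \<in> S \<Longrightarrow> A (i, j) \<in> carrier Q"
    and diag: "\<And>i. i \<in> S \<Longrightarrow> A (i, i) = \<one>\<^bsub>Q\<^esub>"
    and det: "\<And>T. T \<subseteq> S \<Longrightarrow> mat_det Q T (principal_submatrix A T) = \<one>\<^bsub>Q\<^esub>"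
  shows "cycles_vanish Q S A"
proof -
  interpret Q: cring Q unfolding Q_def by (rule ideal.quotient_is_cring[OF I is_cring])
  have "(\<Otimes>\<^bsub>Q\<^esub>i\<in>T. A (i, f i)) = \<zero>\<^bsub>Q\<^esub>"
    if "finite T" "T \<subseteq> S" "T \<noteq> {}" "bij_betw f T T" "\<forall>i\<in>T. f i \<noteq> i" for T f
    using that
  proof (induction T arbitrary: f rule: finite_psubset_induct)
    case (psubset T)
    have IH: "cycles_vanish Q U A" if "U \<subset> T" for U
      unfolding cycles_vanish_def using psubset.IH that psubset.prems(1) psubset.hyps
      by (meson order_trans psubset_imp_subset subset_psubset_trans)
    have finT: "finite T" by (rule psubset.hyps)
    have AT: "A (i, j) \<in> carrier Q" if "i \<in> T" "j \<in> T" for i j using A that psubset.prems(1) by blast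
    let ?P = "{p. p permutes T} - {id}"
    let ?x = "\<lambda>p. \<Otimes>\<^bsub>Q\<^esub>i\<in>T. A (i, p i)"
    let ?y = "\<lambda>p. if evenperm p then ?x p else \<ominus>\<^bsub>Q\<^esub> ?x p"
    have pT: "p i \<in> T" if "p permutes T" "i \<in> T" for p i using that permutes_in_image by metis
    have xc: "?x p \<in> carrier Q" if "p permutes T" for p
      using AT pT[OF that] by (intro Q.finprod_closed) auto
    have "\<one>\<^bsub>Q\<^esub> \<oplus>\<^bsub>Q\<^esub> (\<Oplus>\<^bsub>Q\<^esub>p\<in>?P. ?y p) = \<one>\<^bsub>Q\<^esub>"
      using Q.mat_det_eq_sum[OF finT, of A] AT diag det[OF psubset.prems(1)] psubset.prems(1)
      by (simp add: subset_iff)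
    moreover have "(\<Oplus>\<^bsub>Q\<^esub>p\<in>?P. ?y p) \<in> carrier Q" using xc by (intro Q.finsum_closed) auto
    moreover have "z = \<zero>\<^bsub>Q\<^esub>" if "\<one>\<^bsub>Q\<^esub> \<oplus>\<^bsub>Q\<^esub> z = \<one>\<^bsub>Q\<^esub>" "z \<in> carrier Q" for z
      using Q.add.l_cancel_one[of "\<one>\<^bsub>Q\<^esub>" z] that by simp
    ultimately have sum: "(\<Oplus>\<^bsub>Q\<^esub>p\<in>?P. ?y p) = \<zero>\<^bsub>Q\<^esub>" by blast
    have fixed: "?x p = \<zero>\<^bsub>Q\<^esub>" if "p \<in> ?P" "i \<in> T" "p i = i" for p i
    proof (rule Q.permutation_product_zero[OF finT, of A p])
      show "{i \<in> T. p i \<noteq> i} \<noteq> {}"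
        using that(1) permutes_not_in by (fastforce simp: fun_eq_iff)
      show "cycles_vanish Q {i \<in> T. p i \<noteq> i} A" by (rule IH) (use that in auto)
    qed (use that AT in auto)
    have triv: "\<exists>s\<in>carrier Q. \<exists>t\<in>carrier Q. s \<oplus>\<^bsub>Q\<^esub> t = \<one>\<^bsub>Q\<^esub> \<and>
        s \<otimes>\<^bsub>Q\<^esub> a = \<zero>\<^bsub>Q\<^esub> \<and> t \<otimes>\<^bsub>Q\<^esub> b = \<zero>\<^bsub>Q\<^esub>"
      if "a \<in> carrier Q" "b \<in> carrier Q" "a = \<zero>\<^bsub>Q\<^esub> \<or> b = \<zero>\<^bsub>Q\<^esub>" for a b
      using that(3)
    proof
      assume "a = \<zero>\<^bsub>Q\<^esub>"
      then show ?thesis using that(2) by (intro bexI[of _ "\<one>\<^bsub>Q\<^esub>"] bexI[of _ "\<zero>\<^bsub>Q\<^esub>"]) auto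
    next
      assume "b = \<zero>\<^bsub>Q\<^esub>"
      then show ?thesis using that(1) by (intro bexI[of _ "\<zero>\<^bsub>Q\<^esub>"] bexI[of _ "\<one>\<^bsub>Q\<^esub>"]) auto
    qed
    have comax: "\<exists>s\<in>carrier Q. \<exists>t\<in>carrier Q. s \<oplus>\<^bsub>Q\<^esub> t = \<one>\<^bsub>Q\<^esub> \<and>
        s \<otimes>\<^bsub>Q\<^esub> ?x p = \<zero>\<^bsub>Q\<^esub> \<and> t \<otimes>\<^bsub>Q\<^esub> ?x q = \<zero>\<^bsub>Q\<^esub>"
      if pq: "p \<in> ?P" "q \<in> ?P" "p \<noteq> q" for p q
    proof -
      have c: "?x p \<in> carrier Q" "?x q \<in> carrier Q" using xc pq by auto
      consider (p) "?x p = \<zero>\<^bsub>Q\<^esub>" | (q) "?x q = \<zero>\<^bsub>Q\<^esub>"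
        | (free) "\<And>i. i \<in> T \<Longrightarrow> p i \<noteq> i \<and> q i \<noteq> i" using fixed pq by blast
      then show ?thesis
      proof cases
        case p
        then show ?thesis using triv[OF c] by blast
      next
        case q
        then show ?thesis using triv[OF c] by blast
      next
        case free
        have perm: "p permutes T" "q permutes T" using pq by auto
        obtain v where v: "v \<in> T" "p v \<noteq> q v"
          using pq perm by (metis ext permutes_not_in)
        obtain U f W g E where *: "U \<subset> T" "U \<noteq> {}" "bij_betw f U U" "W \<subset> T" "W \<noteq> {}" "bij_betw g W W"
          "graph_edges p T + graph_edges q T = graph_edges f U + graph_edges g W + E"
          by (rule two_bijections_contain_two_smaller[OF finT permutes_imp_bij[OF perm(1)]
                permutes_imp_bij[OF perm(2)] v])
        have sets: "set_mset (graph_edges p T + graph_edges q T) = (\<lambda>i. (i, p i)) ` T \<union> (\<lambda>i. (i, q i)) ` T"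
          using finT by (simp add: set_graph_edges)
        have Ae: "A e \<in> carrier Q" if "e \<in># graph_edges p T + graph_edges q T" for e
          using that AT pT perm unfolding sets by auto
        have van: "edge_weight Q A (graph_edges h V) = \<zero>\<^bsub>Q\<^esub>"
          if V: "V \<subset> T" "V \<noteq> {}" "bij_betw h V V"
            "set_mset (graph_edges h V) \<subseteq> set_mset (graph_edges p T + graph_edges q T)" for h V
        proof -
          have finV: "finite V" using V finT finite_subset by blast
          have "\<forall>i\<in>V. h i \<noteq> i" using V(1,4) free unfolding sets set_graph_edges[OF finV] by auto
          then have "(\<Otimes>\<^bsub>Q\<^esub>i\<in>V. A (i, h i)) = \<zero>\<^bsub>Q\<^esub>"
            using IH[OF V(1)] V unfolding cycles_vanish_def by blast
          moreover have "A (i, h i) \<in> carrier Q" if "i \<in> V" for i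
            using that V AT bij_betwE[OF V(3)] by blast
          ultimately show ?thesis using finV by (simp add: Q.edge_weight_graph_edges)
        qed
        have zero: "edge_weight Q A (graph_edges f U) = \<zero>\<^bsub>Q\<^esub>" "edge_weight Q A (graph_edges g W) = \<zero>\<^bsub>Q\<^esub>"
          by (rule van; use * in auto)+
        have "edge_weight Q A (graph_edges p T) = ?x p" "edge_weight Q A (graph_edges q T) = ?x q"
          using finT AT pT perm by (auto intro!: Q.edge_weight_graph_edges)
        then show ?thesis
          using quotient_weights_comaximal_annihilators[OF prufer I, folded Q_def, OF Ae *(7) zero]
          by simp
      qed
    qed
    define p where "p i = (if i \<in> T then f i else i)" for i
    have "bij_betw p T T"
      using psubset.prems(3) by (subst bij_betw_cong[of T p f]) (auto simp: p_def)
    then have "p permutes T" by (rule bij_imp_permutes) (simp add: p_def)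
    moreover have "p \<noteq> id" using psubset.prems(2,4) by (auto simp: p_def fun_eq_iff)
    ultimately have pP: "p \<in> ?P" by simp
    have "?y p = \<zero>\<^bsub>Q\<^esub>"
    proof (rule Q.sum_zero_comaximal_annihilators[OF _ _ sum _ pP])
      show "finite ?P" using finT by (simp add: finite_permutations)
      show "?y \<in> ?P \<rightarrow> carrier Q" using xc by auto
      fix p q assume pq: "p \<in> ?P" "q \<in> ?P" "p \<noteq> q"
      then have c: "?x p \<in> carrier Q" "?x q \<in> carrier Q" using xc by auto
      obtain s t where st: "s \<in> carrier Q" "t \<in> carrier Q" "s \<oplus>\<^bsub>Q\<^esub> t = \<one>\<^bsub>Q\<^esub>"
        "s \<otimes>\<^bsub>Q\<^esub> ?x p = \<zero>\<^bsub>Q\<^esub>" "t \<otimes>\<^bsub>Q\<^esub> ?x q = \<zero>\<^bsub>Q\<^esub>" using comax[OF pq] by blast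
      have signed: "r \<otimes>\<^bsub>Q\<^esub> (if b then a else \<ominus>\<^bsub>Q\<^esub> a) = \<zero>\<^bsub>Q\<^esub>"
        if "r \<otimes>\<^bsub>Q\<^esub> a = \<zero>\<^bsub>Q\<^esub>" "r \<in> carrier Q" "a \<in> carrier Q" for r a b
        using that by (simp add: Q.r_minus)
      show "\<exists>s\<in>carrier Q. \<exists>t\<in>carrier Q. s \<oplus>\<^bsub>Q\<^esub> t = \<one>\<^bsub>Q\<^esub> \<and>
        s \<otimes>\<^bsub>Q\<^esub> ?y p = \<zero>\<^bsub>Q\<^esub> \<and> t \<otimes>\<^bsub>Q\<^esub> ?y q = \<zero>\<^bsub>Q\<^esub>"
        using st(1-3) signed[OF st(4,1) c(1)] signed[OF st(5,2) c(2)] by blast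
    qed
    then have "?x p = \<zero>\<^bsub>Q\<^esub>"
      using xc pP by (metis Q.add.inv_eq_1_iff DiffD1 mem_Collect_eq)
    moreover have "?x p = (\<Otimes>\<^bsub>Q\<^esub>i\<in>T. A (i, f i))"
      using AT bij_betwE[OF psubset.prems(3)] by (intro Q.finprod_cong') (auto simp: p_def)
    ultimately show ?case by simp
  qed
  then show ?thesis unfolding cycles_vanish_def using fin finite_subset by metis
qed


lemma cycles_vanish_mono: "cycles_vanish R S A \<Longrightarrow> T \<subseteq> S \<Longrightarrow> cycles_vanish R T A"
  unfolding cycles_vanish_def by (meson subset_trans)

lemma (in ring) finsum_in_ideal:
  assumes "ideal J R" "\<And>i. i \<in> S \<Longrightarrow> f i \<in> J"
  shows "(\<Oplus>i\<in>S. f i) \<in> J"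
proof -
  interpret J: ideal J R by (rule assms(1))
  show ?thesis
    using assms(2)
  proof (induction S rule: infinite_finite_induct)
    case (insert x S)
    then have "(\<Oplus>i\<in>insert x S. f i) = f x \<oplus> (\<Oplus>i\<in>S. f i)"
      using J.Icarr by (intro finsum_insert) auto
    then show ?case using insert by simp
  qed (auto simp: finsum_infinite)
qed

lemma (in cring) genideal_mult_subset:
  assumes sub: "U \<subseteq> carrier R" "V \<subseteq> carrier R" and K: "ideal K R"
    and UV: "\<And>x y. x \<in> U \<Longrightarrow> y \<in> V \<Longrightarrow> x \<otimes> y \<in> K"
    and xy: "x \<in> Idl U" "y \<in> Idl V"
  shows "x \<otimes> y \<in> K"
proof -
  interpret K: ideal K R by (rule K)
  have colon: "ideal {a \<in> carrier R. \<forall>b\<in>B. a \<otimes> b \<in> K} R" if "B \<subseteq> carrier R" for B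
  proof (rule idealI[OF ring_axioms])
    show "subgroup {a \<in> carrier R. \<forall>b\<in>B. a \<otimes> b \<in> K} (add_monoid R)"
    proof (rule add.subgroupI)
      show "{a \<in> carrier R. \<forall>b\<in>B. a \<otimes> b \<in> K} \<noteq> {}"
        using that by (auto intro!: exI[of _ \<zero>] simp: subset_iff)
    next
      fix a assume a: "a \<in> {a \<in> carrier R. \<forall>b\<in>B. a \<otimes> b \<in> K}"
      have "\<ominus> a \<otimes> b \<in> K" if "b \<in> B" for b
      proof -
        have "\<ominus> a \<otimes> b = \<ominus> (a \<otimes> b)" using a that \<open>B \<subseteq> carrier R\<close> by (intro l_minus) auto
        then show ?thesis using a that K.a_inv_closed by simp
      qed
      then show "\<ominus> a \<in> {a \<in> carrier R. \<forall>b\<in>B. a \<otimes> b \<in> K}" using a by auto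
    qed (use that in \<open>auto simp: l_distr subset_iff\<close>)
  next
    fix a x assume a: "a \<in> {a \<in> carrier R. \<forall>b\<in>B. a \<otimes> b \<in> K}" and x: "x \<in> carrier R"
    have "x \<otimes> a \<otimes> b \<in> K" if "b \<in> B" for b
    proof -
      have "x \<otimes> a \<otimes> b = x \<otimes> (a \<otimes> b)" using a x that \<open>B \<subseteq> carrier R\<close> by (intro m_assoc) auto
      then show ?thesis using a that K.I_l_closed x by simp
    qed
    then show "x \<otimes> a \<in> {a \<in> carrier R. \<forall>b\<in>B. a \<otimes> b \<in> K}" using a x by auto
    then show "a \<otimes> x \<in> {a \<in> carrier R. \<forall>b\<in>B. a \<otimes> b \<in> K}" using a x by (auto simp: m_comm)
  qed
  have "Idl U \<subseteq> {a \<in> carrier R. \<forall>b\<in>V. a \<otimes> b \<in> K}"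
    using genideal_minimal[OF colon[OF sub(2)], of U] sub UV by auto
  then have x: "x \<in> carrier R" and "\<And>b. b \<in> V \<Longrightarrow> x \<otimes> b \<in> K" using xy(1) by auto
  then have "b \<otimes> x \<in> K" if "b \<in> V" for b using that sub by (metis m_comm subsetD)
  then have "Idl V \<subseteq> {a \<in> carrier R. \<forall>b\<in>{x}. a \<otimes> b \<in> K}"
    using genideal_minimal[OF colon[of "{x}"], of V] sub x by auto
  then have "y \<otimes> x \<in> K" "y \<in> carrier R" using xy(2) by auto
  then show ?thesis using x by (simp add: m_comm)
qed

section \<open>Matrices with entries in path ideals\<close>

text \<open>The condition on \<open>E\<close> says that it is a flow of one unit from \<open>i\<close> to \<open>j\<close>: a walk from \<open>i\<close>
  to \<open>j\<close>, possibly with some closed walks added. Flows compose by adding multisets, and for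
  \<open>i = j\<close> they are the balanced multisets.\<close>

definition walk_weights :: "('a, 'b) ring_scheme \<Rightarrow> 'i set \<Rightarrow> ('i \<times> 'i \<Rightarrow> 'a) \<Rightarrow> 'i \<Rightarrow> 'i \<Rightarrow> 'a set" where
  "walk_weights R S A i j = {edge_weight R A E |E. E \<noteq> {#} \<and> set_mset E \<subseteq> S \<times> S \<and>
     (\<forall>e\<in>#E. fst e \<noteq> snd e) \<and>
     add_mset j (image_mset fst E) = add_mset i (image_mset snd E)}"

text \<open>A substitute for a partial order on the indices: \<open>G i j\<close> holds the values that an entry at
  \<open>(i, j)\<close> may take. With \<open>G i j\<close> the whole ring for \<open>i\<close> before \<open>j\<close> and zero otherwise,
  the matrices below are the unitriangular ones.\<close>

locale path_ideals = cring R for R :: "('a, 'b) ring_scheme" (structure) +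
  fixes n :: nat and G :: "nat \<Rightarrow> nat \<Rightarrow> 'a set"
  assumes ideal_G: "ideal (G i j) R"
    and G_refl: "i \<in> {1..n} \<Longrightarrow> G i i = {\<zero>}"
    and G_trans: "\<lbrakk>i \<in> {1..n}; j \<in> {1..n}; k \<in> {1..n}; x \<in> G i j; y \<in> G j k\<rbrakk> \<Longrightarrow> x \<otimes> y \<in> G i k"

lemma (in cring) walk_weights_closed:
  assumes "\<And>i j. i \<in> S \<Longrightarrow> j \<in> S \<Longrightarrow> A (i, j) \<in> carrier R"
  shows "walk_weights R S A i j \<subseteq> carrier R"
proof
  fix x assume "x \<in> walk_weights R S A i j"
  then obtain E where E: "x = edge_weight R A E" "set_mset E \<subseteq> S \<times> S"
    unfolding walk_weights_def by blast
  have "A e \<in> carrier R" if "e \<in># E" for e using E(2) that assms by (cases e) blast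
  then show "x \<in> carrier R" unfolding E(1) by (rule edge_weight_closed)
qed

lemma (in cring) entry_in_walk_ideal:
  assumes A: "\<And>i j. i \<in> S \<Longrightarrow> j \<in> S \<Longrightarrow> A (i, j) \<in> carrier R"
    and ij: "i \<in> S" "j \<in> S" "i \<noteq> j"
  shows "A (i, j) \<in> Idl (walk_weights R S A i j)"
proof -
  have "A (i, j) \<in> walk_weights R S A i j"
    unfolding walk_weights_def using ij A edge_weight_single[of A "(i, j)"]
    by (auto intro!: exI[of _ "{#(i, j)#}"])
  then show ?thesis using genideal_self[OF walk_weights_closed[of S A i j]] A by blast
qed

text \<open>A nonempty flow from a vertex to itself contains a cycle, so its weight is a multiple of a
  vanishing cycle product.\<close>

lemma (in cring) path_ideals_of_cycles_vanish:
  assumes A: "\<And>i j. i \<in> {1..n} \<Longrightarrow> j \<in> {1..n} \<Longrightarrow> A (i, j) \<in> carrier R"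
    and van: "cycles_vanish R {1..n} A"
  shows "path_ideals R n (\<lambda>i j. Idl (walk_weights R {1..n} A i j))"
proof (rule path_ideals.intro[OF is_cring path_ideals_axioms.intro])
  let ?W = "walk_weights R {1..n} A"
  have W: "?W i j \<subseteq> carrier R" for i j using A by (rule walk_weights_closed)
  show "ideal (Idl (?W i j)) R" for i j using W by (rule genideal_ideal)
  show "Idl (?W i i) = {\<zero>}" if "i \<in> {1..n}" for i
  proof -
    have "edge_weight R A E = \<zero>" if E: "E \<noteq> {#}" "set_mset E \<subseteq> {1..n} \<times> {1..n}"
      "\<forall>e\<in>#E. fst e \<noteq> snd e" "balanced E" for E
    proof -
      obtain T f where T: "finite T" "T \<noteq> {}" "T \<subseteq> fst ` set_mset E" "bij_betw f T T"
        "graph_edges f T \<subseteq># E" by (rule balanced_contains_graph_edges[OF E(4,1)])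
      have AE: "A e \<in> carrier R" if "e \<in># E" for e using that E(2) A by auto
      have edge: "(i, f i) \<in># E" if "i \<in> T" for i
        using mset_subset_eqD[OF T(5)] that T(1) by (auto simp: set_graph_edges)
      have "fst e \<in> {1..n}" if "e \<in># E" for e using E(2) that mem_Times_iff by blast
      then have "T \<subseteq> {1..n}" using T(3) by blast
      moreover have "f i \<noteq> i" if "i \<in> T" for i using bspec[OF E(3) edge[OF that]] by simp
      ultimately have "(\<Otimes>i\<in>T. A (i, f i)) = \<zero>"
        using van[unfolded cycles_vanish_def, rule_format, of T f] T(2,4) by blast
      then have zero: "edge_weight R A (graph_edges f T) = \<zero>"
        using edge_weight_graph_edges[OF T(1), of A f] AE edge by simp
      have "E = graph_edges f T + (E - graph_edges f T)" using T(5) by simp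
      then have "edge_weight R A E = edge_weight R A (graph_edges f T) \<otimes> edge_weight R A (E - graph_edges f T)"
        using edge_weight_union[of "graph_edges f T" "E - graph_edges f T" A] AE by simp
      then show ?thesis unfolding zero using AE by (auto intro!: l_null edge_weight_closed dest: in_diffD)
    qed
    then have "?W i i \<subseteq> {\<zero>}" by (auto simp: walk_weights_def balanced_def)
    then have "Idl (?W i i) \<subseteq> {\<zero>}" by (rule genideal_minimal[OF zeroideal])
    moreover have "\<zero> \<in> Idl (?W i i)"
      using genideal_ideal[OF W] additive_subgroup.zero_closed ideal.axioms(1) by blast
    ultimately show ?thesis by blast
  qed
  show "x \<otimes> y \<in> Idl (?W i k)" if xy: "x \<in> Idl (?W i j)" "y \<in> Idl (?W j k)" for i j k x y
  proof (rule genideal_mult_subset[OF W W genideal_ideal[OF W] _ xy])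
    fix a b assume "a \<in> ?W i j" "b \<in> ?W j k"
    then obtain E F where E: "a = edge_weight R A E" "E \<noteq> {#}" "set_mset E \<subseteq> {1..n} \<times> {1..n}"
        "\<forall>e\<in>#E. fst e \<noteq> snd e" "add_mset j (image_mset fst E) = add_mset i (image_mset snd E)"
      and F: "b = edge_weight R A F" "F \<noteq> {#}" "set_mset F \<subseteq> {1..n} \<times> {1..n}"
        "\<forall>e\<in>#F. fst e \<noteq> snd e" "add_mset k (image_mset fst F) = add_mset j (image_mset snd F)"
      by (auto simp: walk_weights_def)
    have "add_mset j (add_mset k (image_mset fst (E + F)))
        = add_mset j (image_mset fst E) + add_mset k (image_mset fst F)" by simp
    also have "\<dots> = add_mset j (add_mset i (image_mset snd (E + F)))"
      unfolding E(5) F(5) by simp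
    finally have "add_mset k (image_mset fst (E + F)) = add_mset i (image_mset snd (E + F))" by simp
    moreover have "a \<otimes> b = edge_weight R A (E + F)"
      unfolding E(1) F(1) using A E(3) F(3) by (intro edge_weight_union[symmetric]) auto
    moreover have "E + F \<noteq> {#}" "set_mset (E + F) \<subseteq> {1..n} \<times> {1..n}" "\<forall>e\<in>#E + F. fst e \<noteq> snd e"
      using E(2-4) F(3,4) by (simp_all only: set_mset_union Un_subset_iff ball_Un) auto
    ultimately have "a \<otimes> b \<in> ?W i k"
      unfolding walk_weights_def mem_Collect_eq by blast
    then show "a \<otimes> b \<in> Idl (?W i k)" using genideal_self[OF W] by blast
  qed
qed

context path_ideals
begin

definition path_mats :: "(nat \<times> nat \<Rightarrow> 'a) set" where
  "path_mats = {C \<in> square_mats R {1..n}.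
     \<forall>i\<in>{1..n}. \<forall>j\<in>{1..n}. if i = j then C (i, j) = \<one> else C (i, j) \<in> G i j}"

lemma G_closed: "x \<in> G i j \<Longrightarrow> x \<in> carrier R"
  using ideal.Icarr[OF ideal_G] by blast

lemma zero_in_G: "\<zero> \<in> G i j"
  using ideal_G additive_subgroup.zero_closed ideal.axioms(1) by blast

lemma path_matsD:
  assumes "C \<in> path_mats" "i \<in> {1..n}" "j \<in> {1..n}"
  shows "C (i, j) \<in> carrier R" "C (i, i) = \<one>" "i \<noteq> j \<Longrightarrow> C (i, j) \<in> G i j"
  using assms by (auto simp: path_mats_def square_mats_def)

lemma one_path_mat: "\<one>\<^bsub>mat_monoid R n\<^esub> \<in> path_mats"
  by (auto simp: path_mats_def mat_monoid_def square_mats_def zero_in_G)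

lemma mult_path_mat:
  assumes C: "C \<in> path_mats" and D: "D \<in> path_mats"
  shows "C \<otimes>\<^bsub>mat_monoid R n\<^esub> D \<in> path_mats"
proof -
  note c = path_matsD[OF C] path_matsD[OF D]
  have diag: "(\<Oplus>j\<in>{1..n}. C (i, j) \<otimes> D (j, i)) = \<one>" if i: "i \<in> {1..n}" for i
  proof -
    have "C (i, j) \<otimes> D (j, i) = (if i = j then \<one> else \<zero>)" if j: "j \<in> {1..n}" for j
      using G_trans[OF i j i c(3)[OF i j] c(6)[OF j i]] G_refl[OF i] c(2,5)[OF i j] by auto
    then have "(\<Oplus>j\<in>{1..n}. C (i, j) \<otimes> D (j, i)) = (\<Oplus>j\<in>{1..n}. if i = j then \<one> else \<zero>)"
      by (intro finsum_cong') auto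
    also have "\<dots> = \<one>" using i by (intro add.finprod_singleton) auto
    finally show ?thesis .
  qed
  have off: "(\<Oplus>j\<in>{1..n}. C (i, j) \<otimes> D (j, k)) \<in> G i k"
    if i: "i \<in> {1..n}" and k: "k \<in> {1..n}" and ik: "i \<noteq> k" for i k
  proof (rule finsum_in_ideal[OF ideal_G])
    fix j assume j: "j \<in> {1..n}"
    consider "j = i" | "j = k" | "j \<noteq> i" "j \<noteq> k" by blast
    then show "C (i, j) \<otimes> D (j, k) \<in> G i k"
    proof cases
      case 1
      then show ?thesis using c(2)[OF i k] c(6)[OF i k ik] G_closed by simp
    next
      case 2
      then show ?thesis using c(5)[OF k i] c(3)[OF i k ik] G_closed by simp
    next
      case 3
      then show ?thesis using G_trans[OF i j k c(3)[OF i j] c(6)[OF j k]] by auto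
    qed
  qed
  have "C \<otimes>\<^bsub>mat_monoid R n\<^esub> D \<in> square_mats R {1..n}"
    using c(1,4) by (auto simp: mat_monoid_def square_mats_def intro!: finsum_closed m_closed)
  then show ?thesis
    unfolding path_mats_def using diag off by (auto simp: mat_monoid_def)
qed

text \<open>Contracting a vertex \<open>v\<close> with predecessor \<open>u\<close> merges the two edges \<open>u, v\<close> and \<open>v, f v\<close> into
  one edge, whose label lies in the right ideal by transitivity. This shortens the cycle until a loop
  is left, and the labels of loops are zero.\<close>

lemma closed_path_product_zero:
  assumes "finite T" "T \<noteq> {}" "T \<subseteq> {1..n}" "bij_betw f T T" "\<And>i. i \<in> T \<Longrightarrow> d i \<in> G i (f i)"
  shows "(\<Otimes>i\<in>T. d i) = \<zero>"
  using assms
proof (induction T arbitrary: f d rule: finite_psubset_induct)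
  case (psubset T)
  have dc: "d i \<in> carrier R" if "i \<in> T" for i using psubset.prems(4)[OF that] G_closed by blast
  obtain v where v: "v \<in> T" using psubset.prems(1) by blast
  obtain u where u: "u \<in> T" "f u = v"
    using psubset.prems(3) v by (metis bij_betw_imp_surj_on imageE)
  have inj: "x = y" if "x \<in> T" "y \<in> T" "f x = f y" for x y
    using psubset.prems(3) that by (auto simp: bij_betw_def inj_on_def)
  show ?case
  proof (cases "u = v")
    case True
    then have "d v \<in> G v v" using psubset.prems(4)[OF v] u by simp
    then have "d v = \<zero>" using psubset.prems(2) v G_refl[of v] by blast
    then show ?thesis
      using finprod_zero_subset[OF psubset.hyps, of "{v}" d] v dc by auto
  next
    case False
    define f' where "f' = f(u := f v)"
    define d' where "d' = d(u := d u \<otimes> d v)"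
    let ?T = "T - {v}" and ?U = "T - {v} - {u}"
    have fin: "finite ?U" using psubset.hyps by simp
    have dU: "\<And>i. i \<in> ?U \<Longrightarrow> d i \<in> carrier R" using dc by blast
    have uT: "?T = insert u ?U" and vT: "T = insert v ?T" using u v False by auto
    have fT: "f x \<in> T" if "x \<in> T" for x using psubset.prems(3) that bij_betwE by blast
    have "f' x \<in> ?T" if x: "x \<in> ?T" for x
    proof (cases "x = u")
      case True
      have "f v \<noteq> v" using inj[OF u(1) v] u(2) False by auto
      then show ?thesis using True fT[OF v] by (simp add: f'_def)
    next
      case False
      then have "f x \<noteq> v" using inj[of x u] x u by auto
      then show ?thesis using False x fT by (simp add: f'_def)
    qed
    then have "f' ` ?T \<subseteq> ?T" by blast
    moreover have "inj_on f' ?T"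
      using inj u v by (auto simp: f'_def inj_on_def)
    ultimately have bij: "bij_betw f' ?T ?T"
      using psubset.hyps by (simp add: bij_betw_def endo_inj_surj)
    have d': "d' i \<in> G i (f' i)" if "i \<in> ?T" for i
    proof (cases "i = u")
      case True
      have "d u \<in> G u v" "d v \<in> G v (f v)" using psubset.prems(4) u v by auto
      moreover have "u \<in> {1..n}" "v \<in> {1..n}" "f v \<in> {1..n}"
        using psubset.prems(2) u(1) v fT[OF v] by blast+
      ultimately show ?thesis using G_trans True by (simp add: f'_def d'_def)
    next
      case False
      then show ?thesis using that psubset.prems(4) by (simp add: f'_def d'_def)
    qed
    have "(\<Otimes>i\<in>?T. d' i) = \<zero>"
    proof (rule psubset.IH[OF _ _ _ bij d'])
      show "?T \<subset> T" "?T \<noteq> {}" "?T \<subseteq> {1..n}" using v u False psubset.prems(2) by auto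
    qed
    moreover have "(\<Otimes>i\<in>?T. d' i) = d u \<otimes> d v \<otimes> (\<Otimes>i\<in>?U. d i)"
    proof -
      have "(\<Otimes>i\<in>insert u ?U. d' i) = d' u \<otimes> (\<Otimes>i\<in>?U. d' i)"
        by (rule finprod_insert) (use fin dc u v in \<open>auto simp: d'_def\<close>)
      moreover have "(\<Otimes>i\<in>?U. d' i) = (\<Otimes>i\<in>?U. d i)"
        by (rule finprod_cong') (use dU in \<open>auto simp: d'_def\<close>)
      ultimately show ?thesis using uT by (simp add: d'_def)
    qed
    moreover have "(\<Otimes>i\<in>T. d i) = d v \<otimes> (d u \<otimes> (\<Otimes>i\<in>?U. d i))"
    proof -
      have "(\<Otimes>i\<in>insert v ?T. d i) = d v \<otimes> (\<Otimes>i\<in>?T. d i)"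
        by (rule finprod_insert) (use psubset.hyps dc v in auto)
      moreover have "(\<Otimes>i\<in>insert u ?U. d i) = d u \<otimes> (\<Otimes>i\<in>?U. d i)"
        by (rule finprod_insert) (use fin dc u in auto)
      ultimately show ?thesis using uT vT by simp
    qed
    moreover have "(\<Otimes>i\<in>?U. d i) \<in> carrier R" using dU by (intro finprod_closed) auto
    ultimately show ?thesis using dc[OF u(1)] dc[OF v] by (simp add: m_ac)
  qed
qed

lemma one_principled_path_mat:
  assumes C: "C \<in> path_mats"
  shows "one_principled R n C"
proof -
  have van: "cycles_vanish R {1..n} C"
    unfolding cycles_vanish_def
  proof (intro allI impI, elim conjE)
    fix T f assume T: "T \<subseteq> {1..n}" "T \<noteq> {}" "bij_betw f T T" "\<forall>i\<in>T. f i \<noteq> i"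
    show "(\<Otimes>i\<in>T. C (i, f i)) = \<zero>"
    proof (rule closed_path_product_zero[OF _ T(2,1,3)])
      show "finite T" using T(1) finite_subset by blast
      show "C (i, f i) \<in> G i (f i)" if "i \<in> T" for i
        using that T bij_betwE[OF T(3)] by (intro path_matsD(3)[OF C]) auto
    qed
  qed
  have "mat_det R S (principal_submatrix C S) = \<one>" if S: "S \<subseteq> {1..n}" for S
  proof -
    have fin: "finite S" using S finite_subset by blast
    have CS: "C (i, j) \<in> carrier R" "C (i, i) = \<one>" if "i \<in> S" "j \<in> S" for i j
      using path_matsD(1,2)[OF C] S that by blast+
    have zero: "(\<Otimes>i\<in>S. C (i, p i)) = \<zero>" if p: "p \<in> {p. p permutes S} - {id}" for p
    proof (rule permutation_product_zero[OF fin _ _ refl])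
      show "{i \<in> S. p i \<noteq> i} \<noteq> {}"
        using p permutes_not_in by (fastforce simp: fun_eq_iff)
      show "cycles_vanish R {i \<in> S. p i \<noteq> i} C"
        using van by (rule cycles_vanish_mono) (use S in auto)
    qed (use p CS in auto)
    have "(\<Oplus>p\<in>{p. p permutes S} - {id}.
        if evenperm p then (\<Otimes>i\<in>S. C (i, p i)) else \<ominus> (\<Otimes>i\<in>S. C (i, p i))) = \<zero>"
      by (rule add.finprod_one_eqI) (simp add: zero)
    then show ?thesis using mat_det_eq_sum[OF fin, of C] CS by simp
  qed
  moreover have "C \<in> square_mats R {1..n}" using C by (simp add: path_mats_def)
  ultimately show ?thesis by (simp add: one_principled_def)
qed

lemma mat_monoid_mult_entry:
  "i \<in> {1..n} \<Longrightarrow> k \<in> {1..n} \<Longrightarrow>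
     (C \<otimes>\<^bsub>mat_monoid R n\<^esub> D) (i, k) = (\<Oplus>j\<in>{1..n}. C (i, j) \<otimes> D (j, k))"
  by (simp add: mat_monoid_def)

text \<open>Gaussian elimination inside the set of matrices considered. Here \<open>J\<close> collects the columns
  that may still differ from those of the identity matrix. Multiplying from the left by
  \<open>1 - N\<close>, where \<open>N\<close> is the off-diagonal part of column \<open>j\<close>, clears this column and keeps the cleared ones.\<close>

lemma left_inverse_path_mat_aux:
  assumes "finite J" "C \<in> path_mats"
    "\<And>i j. i \<in> {1..n} \<Longrightarrow> j \<in> {1..n} - J \<Longrightarrow> i \<noteq> j \<Longrightarrow> C (i, j) = \<zero>"
  shows "\<exists>L\<in>path_mats. L \<otimes>\<^bsub>mat_monoid R n\<^esub> C = \<one>\<^bsub>mat_monoid R n\<^esub>"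
  using assms
proof (induction J arbitrary: C rule: finite_induct)
  case empty
  interpret M: monoid "mat_monoid R n" by (rule mat_monoid_monoid)
  have "C = \<one>\<^bsub>mat_monoid R n\<^esub>"
  proof (rule extensionalityI[of _ "{1..n} \<times> {1..n}"])
    show "C \<in> extensional ({1..n} \<times> {1..n})"
      using empty by (auto simp: path_mats_def square_mats_def PiE_iff)
    show "\<one>\<^bsub>mat_monoid R n\<^esub> \<in> extensional ({1..n} \<times> {1..n})" by (simp add: mat_monoid_def)
    fix e assume "e \<in> {1..n} \<times> {1..n}"
    then show "C e = \<one>\<^bsub>mat_monoid R n\<^esub> e"
      using empty.prems(2) path_matsD(2)[OF empty.prems(1)] by (auto simp: mat_monoid_def)
  qed
  then show ?case using one_path_mat M.l_one M.one_closed by metis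
next
  case (insert j J)
  interpret M: monoid "mat_monoid R n" by (rule mat_monoid_monoid)
  have pm: "Z \<in> carrier (mat_monoid R n)" if "Z \<in> path_mats" for Z
    using that by (simp add: path_mats_def mat_monoid_def)
  note c = path_matsD[OF insert.prems(1)]
  define E where "E = restrict (\<lambda>(i, k). if i = k then \<one> else if k = j then \<ominus> C (i, j) else \<zero>)
    ({1..n} \<times> {1..n})"
  have "\<ominus> C (i, j) \<in> G i j" if "i \<in> {1..n}" "j \<in> {1..n}" "i \<noteq> j" for i
    using c(3)[OF that] additive_subgroup.a_inv_closed[OF ideal.axioms(1)[OF ideal_G]] is_abelian_group
    by blast
  then have E: "E \<in> path_mats"
    using c(1) by (auto simp: path_mats_def square_mats_def E_def zero_in_G)
  let ?EC = "E \<otimes>\<^bsub>mat_monoid R n\<^esub> C"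
  have EC: "?EC \<in> path_mats" by (rule mult_path_mat[OF E insert.prems(1)])
  have "?EC (i, k) = \<zero>" if i: "i \<in> {1..n}" and k: "k \<in> {1..n} - J" and ik: "i \<noteq> k" for i k
  proof -
    have kn: "k \<in> {1..n}" using k by blast
    have cl: "E (i, l) \<otimes> C (l, k) \<in> carrier R" if "l \<in> {1..n}" for l
      using path_matsD(1)[OF E i that] c(1)[OF that kn] by simp
    \<comment> \<open>Off-diagonal entries of \<open>E\<close> occur only in column \<open>j\<close>; any other column \<open>k\<close> is cleared in \<open>C\<close>.\<close>
    have "l = i \<or> l = k \<or> E (i, l) \<otimes> C (l, k) = \<zero>" if l: "l \<in> {1..n}" for l
    proof (cases "k = j")
      case True
      then show ?thesis using i l c(1)[OF l kn] by (auto simp: E_def)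
    next
      case False
      then have "l = k \<or> C (l, k) = \<zero>" using insert.prems(2)[OF l] k by blast
      then show ?thesis using path_matsD(1)[OF E i l] by auto
    qed
    then have "(\<Oplus>l\<in>{1..n}. E (i, l) \<otimes> C (l, k)) = (\<Oplus>l\<in>{i, k}. E (i, l) \<otimes> C (l, k))"
      using cl i kn by (intro add.finprod_mono_neutral_cong_right) auto
    also have "\<dots> = E (i, i) \<otimes> C (i, k) \<oplus> E (i, k) \<otimes> C (k, k)"
      using cl i kn ik by simp
    also have "\<dots> = C (i, k) \<oplus> E (i, k)"
      using path_matsD(1,2)[OF E i kn] c(1)[OF i kn] c(2)[OF kn kn] by simp
    also have "\<dots> = \<zero>"
    proof (cases "k = j")
      case True
      then show ?thesis using i kn ik c(1)[OF i kn] by (simp add: E_def r_neg)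
    next
      case False
      then show ?thesis using i kn k ik insert.prems(2)[OF i _ ik] by (simp add: E_def)
    qed
    finally show ?thesis using mat_monoid_mult_entry[OF i kn] by simp
  qed
  from insert.IH[OF EC this] obtain L where L: "L \<in> path_mats"
    "L \<otimes>\<^bsub>mat_monoid R n\<^esub> ?EC = \<one>\<^bsub>mat_monoid R n\<^esub>" by blast
  then have "(L \<otimes>\<^bsub>mat_monoid R n\<^esub> E) \<otimes>\<^bsub>mat_monoid R n\<^esub> C = \<one>\<^bsub>mat_monoid R n\<^esub>"
    using M.m_assoc pm E insert.prems(1) by simp
  then show ?case using mult_path_mat[OF L(1) E] by blast
qed

text \<open>The left inverse has a left inverse of its own, which must be the original matrix; so
  it is a two-sided inverse.\<close>

lemma inverse_path_mat:
  assumes C: "C \<in> path_mats"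
  shows "inv\<^bsub>mat_monoid R n\<^esub> C \<in> path_mats"
proof -
  interpret M: monoid "mat_monoid R n" by (rule mat_monoid_monoid)
  have pm: "Z \<in> carrier (mat_monoid R n)" if "Z \<in> path_mats" for Z
    using that by (simp add: path_mats_def mat_monoid_def)
  have left: "\<exists>L\<in>path_mats. L \<otimes>\<^bsub>mat_monoid R n\<^esub> Z = \<one>\<^bsub>mat_monoid R n\<^esub>" if "Z \<in> path_mats" for Z
    by (rule left_inverse_path_mat_aux[of "{1..n}"]) (use that in auto)
  obtain L where L: "L \<in> path_mats" "L \<otimes>\<^bsub>mat_monoid R n\<^esub> C = \<one>\<^bsub>mat_monoid R n\<^esub>"
    using left[OF C] by blast
  obtain L' where L': "L' \<in> path_mats" "L' \<otimes>\<^bsub>mat_monoid R n\<^esub> L = \<one>\<^bsub>mat_monoid R n\<^esub>"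
    using left[OF L(1)] by blast
  have "L' = C" using M.inv_unique[OF L'(2) L(2)] pm C L(1) L'(1) by simp
  then have "inv\<^bsub>mat_monoid R n\<^esub> C = L"
    using M.inv_unique'[of C L] pm C L L' by simp
  then show ?thesis using L(1) by simp
qed

lemma int_pow_path_mat:
  assumes C: "C \<in> path_mats"
  shows "C [^]\<^bsub>mat_monoid R n\<^esub> (m :: int) \<in> path_mats"
proof -
  have "C [^]\<^bsub>mat_monoid R n\<^esub> (k :: nat) \<in> path_mats" for k
    by (induction k) (use C one_path_mat mult_path_mat in \<open>auto simp: nat_pow_def\<close>)
  then show ?thesis unfolding int_pow_def2 using inverse_path_mat by (simp only: split: if_split) blast
qed

end

section \<open>Integer powers of 1-principled matrices\<close>

lemma (in cring) one_principled_diag: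
  assumes "one_principled R n A" "i \<in> {1..n}"
  shows "A (i, i) = \<one>"
proof -
  have c: "A (i, i) \<in> carrier R"
    using assms by (auto simp: one_principled_def square_mats_def)
  have "mat_det R {i} (principal_submatrix A {i}) = A (i, i)"
    using c by (simp add: mat_det_def principal_submatrix_def)
  then show ?thesis using assms by (auto simp: one_principled_def)
qed

theorem corollary5p8:
  fixes D :: "('a, 'b) ring_scheme" and I :: "'a set" and n :: nat
    and A :: "nat \<times> nat \<Rightarrow> 'a set"
  assumes "prufer_domain D"
    and "ideal I D"
    and "one_principled (D Quot I) n A"
  shows "\<forall>m::int. one_principled (D Quot I) n (A [^]\<^bsub>mat_monoid (D Quot I) n\<^esub> m)"
proof
  fix m :: int
  have "domain D" using assms(1) unfolding prufer_domain_def by (rule conjunct1)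
  then interpret D: domain D .
  interpret Q: cring "D Quot I" by (rule ideal.quotient_is_cring[OF assms(2) D.is_cring])
  have sq: "A \<in> square_mats (D Quot I) {1..n}"
    and det: "\<And>S. S \<subseteq> {1..n} \<Longrightarrow> mat_det (D Quot I) S (principal_submatrix A S) = \<one>\<^bsub>D Quot I\<^esub>"
    using assms(3) unfolding one_principled_def by blast+
  have A: "A (i, j) \<in> carrier (D Quot I)" if "i \<in> {1..n}" "j \<in> {1..n}" for i j
    using sq that unfolding square_mats_def by blast
  have diag: "A (i, i) = \<one>\<^bsub>D Quot I\<^esub>" if "i \<in> {1..n}" for i
    by (rule Q.one_principled_diag[OF assms(3) that])
  have van: "cycles_vanish (D Quot I) {1..n} A"
    by (rule D.prufer_quotient_cycles_vanish[OF assms(1,2) _ A diag det]) auto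
  let ?W = "walk_weights (D Quot I) {1..n} A"
  interpret path_ideals "D Quot I" n "\<lambda>i j. Idl\<^bsub>D Quot I\<^esub> (?W i j)"
    by (rule Q.path_ideals_of_cycles_vanish[OF A van])
  have "A \<in> path_mats"
    unfolding path_mats_def using sq diag Q.entry_in_walk_ideal[of "{1..n}" A] A by simp
  then show "one_principled (D Quot I) n (A [^]\<^bsub>mat_monoid (D Quot I) n\<^esub> m)"
    by (intro one_principled_path_mat int_pow_path_mat)
qed

end
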